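(* Consider the process $\dot x=Ax+Bu+d$, $y=x+n$, $x(0)=x_0$, under the packetized, buffered remote control law described in the context, with $\delta$ satisfying the sampling condition in the context. Consider any DoS signal satisfying Assumptions 1 and 2 with parameters such that $$\frac{1}{T}+\frac{\Delta}{\tau_D}<1 .$$ If the prediction horizon satisfies $$h\delta>\frac{\omega_2}{\omega_1+\omega_2}\,(Q+\Delta),\qquad Q:=(\kappa+\eta\Delta)\Big(1-\frac1T-\frac{\Delta}{\tau_D}\Big)^{-1},$$ with $\omega_1:=\frac{\gamma_1-\sigma\gamma_2}{2\alpha_2}$ and $\omega_2:=\frac{\gamma_2(2+\sigma)}{\alpha_1}$, then the closed-loop system is stable, i.e., for every initial condition $x_0$ and all bounded $d,n$, all closed-loop signals remain bounded, and they converge to zero whenever $d$ and $n$ converge to zero.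
   Context: Process: $x(t)\in\mathbb R^n$, $u(t)\in\mathbb R^m$, $(A,B)$ stabilizable, $d,n:\mathbb R_{\ge0}\to\mathbb R^n$ unknown bounded measurable disturbance and measurement noise; $w:=[d'\;n']'$ and $\|w_t\|_\infty:=\sup_{s\in[0,t]}\|w(s)\|$. Network and DoS: transmission attempts at $t_k=k\Delta$, $k\in\mathbb N_0$, $\Delta>0$. A DoS signal is given by off/on transition times $h_0<h_1<\dots$ with durations $\tau_n\ge0$; $H_n:=\{h_n\}\cup[h_n,h_n+\tau_n)$. For $0\le\tau\le t$, $n(\tau,t)$ is the number of transitions $h_n$ in $[\tau,t)$ and $\Xi(\tau,t):=\bigcup_nH_n\cap[\tau,t]$, with $|\cdot|$ Lebesgue measure. Assumption 1 (DoS frequency): there exist $\eta\ge0$, $\tau_D>0$ with $n(\tau,t)\le\eta+(t-\tau)/\tau_D$ for all $0\le\tau\le t$. Assumption 2 (DoS duration): there exist $\kappa\ge0$, $T>1$ with $|\Xi(\tau,t)|\le\kappa+(t-\tau)/T$ for all $0\le\tau\le t$. A transmission attempt at $t_k$ fails iff $t_k\in\bigcup_nH_n$; $z_0<z_1<\dots$ are the successful transmission times. Controller: $K$ with $\Phi:=A+BK$ Hurwitz. $\delta:=\Delta/b$, $b\in\mathbb N_1$; $A_\delta:=e^{A\delta}$, $B_\delta:=\int_0^\delta e^{A\tau}B\,d\tau$; $h\in\mathbb N_1$ buffer size. At each $z_m$: $\alpha_0(z_m)=y(z_m)$, $u_p(z_m)=K\alpha_p(z_m)$, $\alpha_{p+1}(z_m)=A_\delta\alpha_p(z_m)+B_\delta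 u_p(z_m)$, $p=0,\dots,h-2$. With $I_p(z_m):=[z_m+p\delta,\min\{z_m+(p+1)\delta,z_{m+1}\})$ for $p\le h-2$ and $I_{h-1}(z_m):=[z_m+(h-1)\delta,z_{m+1})$, the applied input is $u(t)=0$ on $[0,z_0)$ and $u(t)=u_p(z_m)$ on $I_p(z_m)$. Constants: $M$ symmetric positive definite, $P$ solves $\Phi'P+P\Phi+M=0$; $\alpha_1,\alpha_2$ smallest and largest eigenvalues of $P$; $\gamma_1$ smallest eigenvalue of $M$; $\gamma_2:=\|2PBK\|$; $\mu_A$ the largest eigenvalue of $(A+A')/2$; $\sigma>0$ with $\gamma_1-\sigma\gamma_2>0$. Sampling condition: $\delta\le\frac{1}{\mu_A}\log[(\frac{\sigma}{1+\sigma})\frac{\mu_A}{\max\{\|\Phi\|,1\}}+1]$ if $\mu_A>0$, and $\delta\le(\frac{\sigma}{1+\sigma})\frac{1}{\max\{\|\Phi\|,1\}}$ if $\mu_A\le0$. *)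

theory Defs
  imports "HOL-Analysis.Analysis"
begin

primrec mpow :: "real^'n^'n \<Rightarrow> nat \<Rightarrow> real^'n^'n" where
  "mpow M 0 = mat 1"
| "mpow M (Suc k) = M ** mpow M k"

definition mexp :: "real^'n^'n \<Rightarrow> real^'n^'n" where
  "mexp M = (\<Sum>k. (1 / fact k) *\<^sub>R mpow M k)"

definition cmat :: "real^'n^'m \<Rightarrow> complex^'n^'m" where
  "cmat M = (\<chi> i j. complex_of_real (M $ i $ j))"

definition hurwitz :: "real^'n^'n \<Rightarrow> bool" where
  "hurwitz M \<longleftrightarrow> (\<forall>(lam::complex) (v::complex^'n). v \<noteq> 0 \<and> cmat M *v v = lam *s v \<longrightarrow> Re lam < 0)"

definition real_eigenvalues :: "real^'n^'n \<Rightarrow> real set" where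
  "real_eigenvalues M = {lam. \<exists>v. v \<noteq> 0 \<and> M *v v = lam *\<^sub>R v}"

definition sym_posdef :: "real^'n^'n \<Rightarrow> bool" where
  "sym_posdef M \<longleftrightarrow> transpose M = M \<and> (\<forall>x. x \<noteq> 0 \<longrightarrow> x \<bullet> (M *v x) > 0)"

definition opnorm :: "real^'n^'m \<Rightarrow> real" where
  "opnorm M = onorm (\<lambda>x. M *v x)"

text \<open>A DoS signal: pulses indexed by a downward closed index set I
  (finitely or infinitely many), off/on transition times ht, durations tau.\<close>
definition dos_signal :: "nat set \<Rightarrow> (nat \<Rightarrow> real) \<Rightarrow> (nat \<Rightarrow> real) \<Rightarrow> bool" where
  "dos_signal I ht tau \<longleftrightarrow>
     (\<forall>i j. i \<in> I \<longrightarrow> j \<le> i \<longrightarrow> j \<in> I) \<and>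
     (\<forall>i\<in>I. 0 \<le> ht i \<and> 0 \<le> tau i) \<and>
     (\<forall>i\<in>I. \<forall>j\<in>I. i < j \<longrightarrow> ht i < ht j)"

definition dos_H :: "(nat \<Rightarrow> real) \<Rightarrow> (nat \<Rightarrow> real) \<Rightarrow> nat \<Rightarrow> real set" where
  "dos_H ht tau i = {ht i} \<union> {ht i ..< ht i + tau i}"

definition dos_set :: "nat set \<Rightarrow> (nat \<Rightarrow> real) \<Rightarrow> (nat \<Rightarrow> real) \<Rightarrow> real set" where
  "dos_set I ht tau = (\<Union>i\<in>I. dos_H ht tau i)"

definition dos_trans :: "nat set \<Rightarrow> (nat \<Rightarrow> real) \<Rightarrow> real \<Rightarrow> real \<Rightarrow> nat set" where
  "dos_trans I ht s t = {i\<in>I. s \<le> ht i \<and> ht i < t}"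

definition dos_frequency :: "nat set \<Rightarrow> (nat \<Rightarrow> real) \<Rightarrow> real \<Rightarrow> real \<Rightarrow> bool" where
  "dos_frequency I ht eta tauD \<longleftrightarrow>
     (\<forall>s t. 0 \<le> s \<longrightarrow> s \<le> t \<longrightarrow>
        finite (dos_trans I ht s t) \<and> real (card (dos_trans I ht s t)) \<le> eta + (t - s) / tauD)"

definition dos_duration :: "nat set \<Rightarrow> (nat \<Rightarrow> real) \<Rightarrow> (nat \<Rightarrow> real) \<Rightarrow> real \<Rightarrow> real \<Rightarrow> bool" where
  "dos_duration I ht tau kappa T \<longleftrightarrow>
     (\<forall>s t. 0 \<le> s \<longrightarrow> s \<le> t \<longrightarrow>
        measure lborel (dos_set I ht tau \<inter> {s..t}) \<le> kappa + (t - s) / T)"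

definition succ_time :: "nat set \<Rightarrow> (nat \<Rightarrow> real) \<Rightarrow> (nat \<Rightarrow> real) \<Rightarrow> real \<Rightarrow> nat \<Rightarrow> real" where
  "succ_time I ht tau Delta m =
     Delta * real (Infinite_Set.enumerate {k::nat. real k * Delta \<notin> dos_set I ht tau} m)"

definition A_disc :: "real^'n^'n \<Rightarrow> real \<Rightarrow> real^'n^'n" where
  "A_disc A delta = mexp (delta *\<^sub>R A)"

definition B_disc :: "real^'n^'n \<Rightarrow> real^'m^'n \<Rightarrow> real \<Rightarrow> real^'m^'n" where
  "B_disc A B delta = integral {0..delta} (\<lambda>s. mexp (s *\<^sub>R A) ** B)"

primrec pred_state ::
  "real^'n^'n \<Rightarrow> real^'m^'n \<Rightarrow> real^'n^'m \<Rightarrow> real \<Rightarrow> real^'n \<Rightarrow> nat \<Rightarrow> real^'n" where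
  "pred_state A B K delta y0 0 = y0"
| "pred_state A B K delta y0 (Suc p) =
     A_disc A delta *v pred_state A B K delta y0 p + B_disc A B delta *v (K *v pred_state A B K delta y0 p)"

text \<open>Applied input: u(t) = 0 on [0,z_0); on [z_m, z_{m+1}), u(t) = u_p(z_m) = K alpha_p(z_m)
  with p = min(h-1, floor((t - z_m)/delta)), which is exactly t \<in> I_p(z_m).\<close>
definition ctrl_input ::
  "real^'n^'n \<Rightarrow> real^'m^'n \<Rightarrow> real^'n^'m \<Rightarrow> real \<Rightarrow> nat \<Rightarrow> (nat \<Rightarrow> real) \<Rightarrow> (real \<Rightarrow> real^'n) \<Rightarrow> real \<Rightarrow> real^'m" where
  "ctrl_input A B K delta h z y t =
     (if t < z 0 then 0
      else (let m = (LEAST m. t < z (Suc m));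
                p = min (h - 1) (nat \<lfloor>(t - z m) / delta\<rfloor>)
            in K *v pred_state A B K delta (y (z m)) p))"

end

theory Submission
  imports Defs "HOL-Computational_Algebra.Fundamental_Theorem_Algebra"
begin

text \<open>
  Over one period between two successful transmissions, compare the true state with the nominal
  trajectory, which starts from the true state and is free of disturbance and noise. Since the
  predictor is the exact discretisation of the plant, along the nominal trajectory the prediction
  is exact at the sampling instants; for \<open>h\<delta>\<close> time units the Lyapunov function
  \<open>V x = x \<bullet> P x\<close> then decays at rate \<open>\<omega>\<^sub>1\<close>, and afterwards, under the last buffered input, it
  grows at most at rate \<open>\<omega>\<^sub>2\<close>. The two DoS assumptions bound the length of a period by
  \<open>Q + \<Delta>\<close>, so by the horizon condition the nominal period map contracts \<open>V\<close>.
  By linearity and Gronwall's inequality the true state deviates from the nominal one by at most a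
  constant times the size of disturbance and noise, which yields
  \<open>V\<^sub>m\<^sub>+\<^sub>1 \<le> \<lambda> V\<^sub>m + c w\<^sub>m\<^sup>2\<close> with \<open>\<lambda> < 1\<close> at the successful transmissions.
\<close>

section \<open>Symmetric matrices\<close>

text \<open>\<open>P\<close> is given only as a solution of the Lyapunov equation and
  \<open>hurwitz\<close> speaks only of eigenvalues. Symmetry and definiteness of \<open>P\<close>
  therefore rest on the decay of the flow of \<open>A + B ** K\<close>, which is obtained without a
  Jordan form: a polynomial annihilating one vector is split into linear factors over the complex
  numbers. The disturbance is merely measurable, so the true state satisfies an integral equation
  and need not be differentiable. Hence \<open>V\<close> is differentiated only along the nominal
  trajectory. The rates arise from writing the held input as \<open>K\<close> times the current
  state plus \<open>K\<close> times an error. Within the buffer the sampling condition keeps the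
  error below \<open>sigma\<close> times the current state, which gives \<open>omega1\<close>.
  Beyond it the error is at most \<open>1 + sigma\<close> times the state at the end of the horizon
  plus the current state; the coefficients add up to the \<open>2 + sigma\<close> of
  \<open>omega2\<close>. A pulse can spoil an attempt whose effect lasts until the next one, so
  every pulse is lengthened by \<open>Delta\<close>. This is the origin of
  \<open>Delta / tauD\<close> in the rate condition and of \<open>eta * Delta\<close> in
  \<open>Q\<close>.\<close>

lemma inner_matrix_transpose:
  fixes S :: "real^'n^'m"
  shows "x \<bullet> (S *v y) = (transpose S *v x) \<bullet> y"
  by (metis dot_lmul_matrix transpose_matrix_vector)

lemma linear_coeff_zero_if_quadratic_nonneg:
  fixes a b :: real
  assumes "\<And>t. 0 \<le> a * t + b * t\<^sup>2"
  shows "a = 0"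
proof (rule ccontr)
  assume "a \<noteq> 0"
  \<comment> \<open>A step against the sign of \<open>a\<close>, short enough for the linear term to
    beat the quadratic one; the \<open>+ 1\<close> keeps the denominator nonzero when
    \<open>b = 0\<close>.\<close>
  define t where "t = - a / (2 * (\<bar>b\<bar> + 1))"
  have "a * t + b * t\<^sup>2 \<le> a * t + \<bar>b\<bar> * t\<^sup>2"
    by (simp add: mult_right_mono)
  also have "\<dots> = a\<^sup>2 * ((\<bar>b\<bar> - 2 * (\<bar>b\<bar> + 1)) / (2 * (\<bar>b\<bar> + 1))\<^sup>2)"
  proof -
    have "a * (- a / c) + \<bar>b\<bar> * (- a / c)\<^sup>2 = a\<^sup>2 * ((\<bar>b\<bar> - c) / c\<^sup>2)" if "c \<noteq> 0" for c
      using that by (simp add: field_simps power2_eq_square)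
    from this[of "2 * (\<bar>b\<bar> + 1)"] show ?thesis unfolding t_def by simp
  qed
  also have "\<dots> < 0"
    using \<open>a \<noteq> 0\<close> by (intro mult_pos_neg divide_neg_pos) auto
  finally show False using assms[of t] by simp
qed

text \<open>A null vector minimises the form, so the first-order change in the direction
  \<open>w = S *v v\<close>, which is twice \<open>w \<bullet> w\<close>, has to vanish.\<close>

lemma psd_null_vector:
  fixes S :: "real^'n^'n"
  assumes sym: "transpose S = S" and psd: "\<And>x. 0 \<le> x \<bullet> (S *v x)" and null: "v \<bullet> (S *v v) = 0"
  shows "S *v v = 0"
proof -
  define w where "w = S *v v"
  have "0 \<le> (2 * (w \<bullet> w)) * t + (w \<bullet> (S *v w)) * t\<^sup>2" for t
  proof -
    have "v \<bullet> (S *v w) = w \<bullet> w"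
      by (simp add: inner_matrix_transpose sym w_def)
    moreover have "0 \<le> (v + t *\<^sub>R w) \<bullet> (S *v (v + t *\<^sub>R w))" by (rule psd)
    ultimately show ?thesis
      using null
      by (simp add: matrix_vector_right_distrib matrix_vector_mult_scaleR inner_add_left
          inner_add_right power2_eq_square algebra_simps flip: w_def)
  qed
  from linear_coeff_zero_if_quadratic_nonneg[OF this] show ?thesis by (simp add: w_def)
qed

text \<open>Take a maximiser \<open>v\<close> of the form on the unit sphere, with value
  \<open>l\<close>. Then \<open>l I - S\<close> is positive semidefinite with null vector
  \<open>v\<close>, so \<open>v\<close> lies in its kernel; no Lagrange multiplier is
  involved.\<close>

lemma symmetric_max_eigenvalue:
  fixes S :: "real^'n^'n"
  assumes sym: "transpose S = S"
  obtains l where "l \<in> real_eigenvalues S" "\<And>x. x \<bullet> (S *v x) \<le> l * (x \<bullet> x)"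
proof -
  have cont: "continuous_on (sphere 0 1) (\<lambda>x. x \<bullet> (S *v x))"
    by (intro continuous_on_inner continuous_on_id linear_continuous_on matrix_vector_mul_bounded_linear)
  have "sphere (0::real^'n) 1 \<noteq> {}" by (simp add: sphere_eq_empty)
  then obtain v where v: "norm v = 1" and max: "\<And>x. norm x = 1 \<Longrightarrow> x \<bullet> (S *v x) \<le> v \<bullet> (S *v v)"
    using continuous_attains_sup[OF compact_sphere _ cont] by auto
  define l where "l = v \<bullet> (S *v v)"
  define R where "R = l *\<^sub>R mat 1 - S"
  have R: "R *v x = l *\<^sub>R x - S *v x" for x
    by (simp add: R_def matrix_vector_mult_diff_rdistrib flip: scaleR_matrix_vector_assoc)
  have bound: "x \<bullet> (S *v x) \<le> l * (x \<bullet> x)" for x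
  proof (cases "x = 0")
    case False
    have "x \<bullet> (S *v x) = (norm x)\<^sup>2 * (sgn x \<bullet> (S *v sgn x))"
      using False by (simp add: sgn_div_norm matrix_vector_mult_scaleR power2_eq_square field_simps)
    also have "\<dots> \<le> (norm x)\<^sup>2 * l"
      unfolding l_def using max[of "sgn x"] False by (intro mult_left_mono) (auto simp: norm_sgn)
    finally show ?thesis by (simp add: power2_norm_eq_inner mult.commute)
  qed simp
  have "transpose R = R"
  proof -
    have "transpose (l *\<^sub>R mat 1 - S) = l *\<^sub>R mat 1 - transpose S"
      by (auto simp: transpose_def vec_eq_iff mat_def)
    then show ?thesis by (simp add: R_def sym)
  qed
  moreover have "0 \<le> x \<bullet> (R *v x)" for x
    using bound[of x] by (simp add: R inner_diff_right)
  moreover have "v \<bullet> (R *v v) = 0"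
    using v by (simp add: R inner_diff_right l_def norm_eq_1)
  ultimately have "R *v v = 0" by (rule psd_null_vector)
  then have "l \<in> real_eigenvalues S"
    using v by (auto simp: real_eigenvalues_def R intro!: exI[of _ v])
  then show ?thesis using bound that by blast
qed

text \<open>Eigenvectors of distinct eigenvalues are orthogonal, hence independent, hence finitely
  many. Finiteness is what gives \<open>Min\<close> and \<open>Max\<close> of the spectrum their
  meaning.\<close>

lemma finite_real_eigenvalues_symmetric:
  fixes S :: "real^'n^'n"
  assumes sym: "transpose S = S"
  shows "finite (real_eigenvalues S)"
proof -
  define f where "f l = (SOME v. v \<noteq> 0 \<and> S *v v = l *\<^sub>R v)" for l
  have f: "f l \<noteq> 0" "S *v f l = l *\<^sub>R f l" if "l \<in> real_eigenvalues S" for l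
    using someI_ex[of "\<lambda>v. v \<noteq> 0 \<and> S *v v = l *\<^sub>R v"] that
    by (auto simp: f_def real_eigenvalues_def)
  have orth: "f l \<bullet> f k = 0" if "l \<in> real_eigenvalues S" "k \<in> real_eigenvalues S" "l \<noteq> k" for l k
  proof -
    have "f l \<bullet> (S *v f k) = (S *v f l) \<bullet> f k"
      by (simp add: inner_matrix_transpose sym)
    then show ?thesis using f that by simp
  qed
  have inj: "inj_on f (real_eigenvalues S)"
    by (rule inj_onI) (metis f(1) inner_eq_zero_iff orth)
  have "pairwise orthogonal (f ` real_eigenvalues S)"
    by (auto simp: pairwise_def orthogonal_def intro!: orth)
  then have "independent (f ` real_eigenvalues S)"
    using f(1) by (intro pairwise_orthogonal_independent) auto
  then have "finite (f ` real_eigenvalues S)" by (rule independent_imp_finite)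
  then show ?thesis using inj finite_image_iff by blast
qed

lemma rayleigh_le_Max:
  fixes S :: "real^'n^'n"
  assumes "transpose S = S"
  shows "x \<bullet> (S *v x) \<le> Max (real_eigenvalues S) * (norm x)\<^sup>2"
proof -
  obtain l where l: "l \<in> real_eigenvalues S" "x \<bullet> (S *v x) \<le> l * (x \<bullet> x)"
    using symmetric_max_eigenvalue[OF assms] by blast
  have "l \<le> Max (real_eigenvalues S)"
    using l finite_real_eigenvalues_symmetric[OF assms] by simp
  then have "l * (x \<bullet> x) \<le> Max (real_eigenvalues S) * (x \<bullet> x)"
    by (intro mult_right_mono) auto
  with l show ?thesis by (simp add: power2_norm_eq_inner)
qed

lemma symmetric_min_eigenvalue:
  fixes S :: "real^'n^'n"
  assumes sym: "transpose S = S"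
  obtains l where "l \<in> real_eigenvalues S" "\<And>x. l * (x \<bullet> x) \<le> x \<bullet> (S *v x)"
proof -
  have neg: "(- S) *v x = - (S *v x)" for x
    using matrix_vector_mult_diff_rdistrib[of 0 S x] by simp
  have "transpose (- S) = - S"
    using sym by (auto simp: transpose_def vec_eq_iff)
  then obtain l where l: "l \<in> real_eigenvalues (- S)" "\<And>x. x \<bullet> ((- S) *v x) \<le> l * (x \<bullet> x)"
    using symmetric_max_eigenvalue by blast
  have "- l \<in> real_eigenvalues S"
    using l(1) by (auto simp: real_eigenvalues_def neg) (metis minus_minus)
  moreover have "- l * (x \<bullet> x) \<le> x \<bullet> (S *v x)" for x
    using l(2)[of x] by (simp add: neg)
  ultimately show ?thesis using that by blast
qed

lemma Min_le_rayleigh: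
  fixes S :: "real^'n^'n"
  assumes "transpose S = S"
  shows "Min (real_eigenvalues S) * (norm x)\<^sup>2 \<le> x \<bullet> (S *v x)"
proof -
  obtain l where l: "l \<in> real_eigenvalues S" "l * (x \<bullet> x) \<le> x \<bullet> (S *v x)"
    using symmetric_min_eigenvalue[OF assms] by blast
  have "Min (real_eigenvalues S) \<le> l"
    using l finite_real_eigenvalues_symmetric[OF assms] by simp
  then have "Min (real_eigenvalues S) * (x \<bullet> x) \<le> l * (x \<bullet> x)"
    by (intro mult_right_mono) auto
  with l show ?thesis by (simp add: power2_norm_eq_inner)
qed

lemma posdef_Min_eigenvalue_pos:
  fixes S :: "real^'n^'n"
  assumes "sym_posdef S"
  shows "0 < Min (real_eigenvalues S)"
proof -
  have sym: "transpose S = S" using assms by (simp add: sym_posdef_def)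
  have "real_eigenvalues S \<noteq> {}" using symmetric_max_eigenvalue[OF sym] by blast
  then have "Min (real_eigenvalues S) \<in> real_eigenvalues S"
    by (intro Min_in finite_real_eigenvalues_symmetric[OF sym])
  then obtain v where "v \<noteq> 0" "S *v v = Min (real_eigenvalues S) *\<^sub>R v"
    by (auto simp: real_eigenvalues_def)
  then show ?thesis
    using assms by (metis inner_gt_zero_iff inner_scaleR_right sym_posdef_def zero_less_mult_pos2)
qed

lemma posdef_Max_eigenvalue_pos:
  fixes S :: "real^'n^'n"
  assumes "sym_posdef S"
  shows "0 < Max (real_eigenvalues S)"
proof -
  have sym: "transpose S = S" using assms by (simp add: sym_posdef_def)
  have "real_eigenvalues S \<noteq> {}" using symmetric_max_eigenvalue[OF sym] by blast
  then have "Min (real_eigenvalues S) \<le> Max (real_eigenvalues S)"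
    using finite_real_eigenvalues_symmetric[OF sym] by simp
  then show ?thesis using posdef_Min_eigenvalue_pos[OF assms] by linarith
qed

section \<open>The matrix exponential\<close>

lemma bounded_bilinear_matrix_mult:
  "bounded_bilinear ((**) :: real^'n^'m \<Rightarrow> real^'p^'n \<Rightarrow> real^'p^'m)"
proof -
  have "linear (\<lambda>B. (A :: real^'n^'m) ** (B :: real^'p^'n))" for A
    by (rule linearI) (auto simp: matrix_matrix_mult_def vec_eq_iff sum.distrib sum_distrib_left
        algebra_simps)
  moreover have "linear (\<lambda>A. (A :: real^'n^'m) ** (B :: real^'p^'n))" for B
    by (rule linearI) (auto simp: matrix_matrix_mult_def vec_eq_iff sum.distrib sum_distrib_left
        algebra_simps)
  ultimately have "bilinear ((**) :: real^'n^'m \<Rightarrow> real^'p^'n \<Rightarrow> real^'p^'m)"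
    by (simp add: bilinear_def)
  then show ?thesis by (simp add: bilinear_conv_bounded_bilinear)
qed

lemma bounded_bilinear_matrix_vector_mult:
  "bounded_bilinear ((*v) :: real^'n^'m \<Rightarrow> real^'n \<Rightarrow> real^'m)"
proof -
  have "linear (\<lambda>A. (A :: real^'n^'m) *v v)" for v
    by (rule linearI) (auto simp: matrix_vector_mult_def vec_eq_iff sum.distrib sum_distrib_left
        algebra_simps)
  then have "bilinear ((*v) :: real^'n^'m \<Rightarrow> real^'n \<Rightarrow> real^'m)"
    by (simp add: bilinear_def)
  then show ?thesis by (simp add: bilinear_conv_bounded_bilinear)
qed

lemmas bounded_linear_matrix_mult_left =
  bounded_bilinear.bounded_linear_left[OF bounded_bilinear_matrix_mult]
lemmas bounded_linear_matrix_mult_right =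
  bounded_bilinear.bounded_linear_right[OF bounded_bilinear_matrix_mult]
lemmas bounded_linear_matrix_apply =
  bounded_bilinear.bounded_linear_left[OF bounded_bilinear_matrix_vector_mult]

lemma bounded_linear_matrix_entry: "bounded_linear (\<lambda>X::real^'n^'m. X $ i $ j)"
  by (rule bounded_linear_compose[OF bounded_linear_vec_nth bounded_linear_vec_nth])

lemma mpow_commute: "mpow A k ** A = A ** mpow A k"
  by (induction k) (auto simp: matrix_mul_assoc[symmetric])

lemma mpow_scaleR: "mpow (t *\<^sub>R A) k = t ^ k *\<^sub>R mpow (A :: real^'n^'n) k"
proof (induction k)
  case (Suc k)
  then show ?case
    by (simp add: bounded_bilinear.scaleR_left[OF bounded_bilinear_matrix_mult]
        bounded_bilinear.scaleR_right[OF bounded_bilinear_matrix_mult])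
qed simp

lemma norm_mpow_le: "\<exists>a\<ge>0. \<exists>c\<ge>0. \<forall>k. norm (mpow (A :: real^'n^'n) k) \<le> a * c ^ k"
proof -
  obtain c where c: "c \<ge> 0" "\<And>X. norm (A ** X) \<le> norm (X :: real^'n^'n) * c"
    using bounded_linear.nonneg_bounded[OF bounded_linear_matrix_mult_right[of A]] by blast
  have "norm (mpow A k) \<le> norm (mat 1 :: real^'n^'n) * c ^ k" for k
  proof (induction k)
    case (Suc k)
    have "norm (mpow A (Suc k)) \<le> norm (mpow A k) * c" using c by simp
    also have "\<dots> \<le> norm (mat 1 :: real^'n^'n) * c ^ k * c"
      using c Suc by (intro mult_right_mono)
    finally show ?case by (simp add: mult_ac)
  qed simp
  then show ?thesis using c(1) norm_ge_zero by blast
qed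

lemma summable_mexp: "summable (\<lambda>k. (1 / fact k) *\<^sub>R mpow (A :: real^'n^'n) k)"
proof -
  obtain a c where ac: "a \<ge> 0" "c \<ge> 0" "\<And>k. norm (mpow A k) \<le> a * c ^ k"
    using norm_mpow_le by blast
  have "summable (\<lambda>k. a * (inverse (fact k) * c ^ k))"
    by (intro summable_mult summable_exp)
  then show ?thesis
    by (rule summable_comparison_test') (use ac in \<open>auto simp: divide_simps mult_ac\<close>)
qed

text \<open>Each entry is a scalar power series in \<open>t\<close>, which turns differentiation of
  the exponential into term-by-term differentiation of real series.\<close>

lemma mexp_entry_sums:
  "(\<lambda>k. (mpow (A :: real^'n^'n) k $ i $ j / fact k) * t ^ k) sums (mexp (t *\<^sub>R A) $ i $ j)"
proof -
  have "(\<lambda>k. (1 / fact k) *\<^sub>R mpow (t *\<^sub>R A) k) sums mexp (t *\<^sub>R A)"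
    unfolding mexp_def by (rule summable_sums[OF summable_mexp])
  from bounded_linear.sums[OF bounded_linear_matrix_entry this, of i j]
  show ?thesis by (simp add: mpow_scaleR mult_ac)
qed

lemma mexp_zero: "mexp 0 = (mat 1 :: real^'n^'n)"
proof -
  have "mexp (0 *\<^sub>R (0 :: real^'n^'n)) $ i $ j = mat 1 $ i $ j" for i j
    using sums_unique2[OF mexp_entry_sums[of 0 i j 0]
        powser_sums_zero[of "\<lambda>k. mpow (0 :: real^'n^'n) k $ i $ j / fact k"]]
    by simp
  then show ?thesis by (simp add: vec_eq_iff)
qed

lemma mexp_commute: "mexp A ** A = A ** mexp (A :: real^'n^'n)"
proof -
  have "mexp A ** A = (\<Sum>k. ((1 / fact k) *\<^sub>R mpow A k) ** A)"
    unfolding mexp_def by (rule bounded_linear.suminf[OF bounded_linear_matrix_mult_left summable_mexp])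
  also have "\<dots> = (\<Sum>k. A ** ((1 / fact k) *\<^sub>R mpow A k))"
    by (simp add: bounded_bilinear.scaleR_left[OF bounded_bilinear_matrix_mult]
        bounded_bilinear.scaleR_right[OF bounded_bilinear_matrix_mult] mpow_commute)
  also have "\<dots> = A ** mexp A"
    unfolding mexp_def
    by (rule bounded_linear.suminf[OF bounded_linear_matrix_mult_right summable_mexp, symmetric])
  finally show ?thesis .
qed

lemma mexp_scaleR_commute: "mexp (t *\<^sub>R A) ** A = A ** mexp (t *\<^sub>R (A :: real^'n^'n))"
proof (cases "t = 0")
  case False
  have "t *\<^sub>R (mexp (t *\<^sub>R A) ** A) = t *\<^sub>R (A ** mexp (t *\<^sub>R A))"
    using mexp_commute[of "t *\<^sub>R A"]
    by (simp add: bounded_bilinear.scaleR_left[OF bounded_bilinear_matrix_mult]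
        bounded_bilinear.scaleR_right[OF bounded_bilinear_matrix_mult])
  then show ?thesis using False by simp
qed (simp add: mexp_zero)

lemma has_vector_derivative_vec_lambda:
  fixes f :: "real \<Rightarrow> 'a::euclidean_space^'n"
  assumes "\<And>i. ((\<lambda>t. f t $ i) has_vector_derivative f' $ i) F"
  shows "(f has_vector_derivative f') F"
proof -
  have "((\<lambda>t. \<Sum>i\<in>UNIV. axis i (f t $ i)) has_vector_derivative (\<Sum>i\<in>UNIV. axis i (f' $ i))) F"
  proof (rule has_vector_derivative_sum)
    fix i :: 'n
    have "linear (axis i :: 'a \<Rightarrow> 'a^'n)"
      by (rule linearI) (auto simp: axis_def vec_eq_iff)
    then have "bounded_linear (axis i :: 'a \<Rightarrow> 'a^'n)" by (simp add: linear_conv_bounded_linear)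
    from bounded_linear.has_vector_derivative[OF this assms[of i]]
    show "((\<lambda>t. axis i (f t $ i)) has_vector_derivative axis i (f' $ i)) F" .
  qed
  moreover have "(\<Sum>i\<in>UNIV. axis i (x $ i)) = x" for x :: "'a^'n"
    by (simp add: vec_eq_iff axis_def if_distrib cong: if_cong)
  ultimately show ?thesis by simp
qed

lemma has_vector_derivative_mexp:
  "((\<lambda>t. mexp (t *\<^sub>R (A :: real^'n^'n))) has_vector_derivative (A ** mexp (t *\<^sub>R A))) (at t)"
proof (intro has_vector_derivative_vec_lambda)
  fix i j
  define c where "c k = mpow A k $ i $ j / fact k" for k
  have sm: "summable (\<lambda>k. c k * s ^ k)" for s
    unfolding c_def using mexp_entry_sums sums_summable by blast
  have eq: "(\<lambda>t. mexp (t *\<^sub>R A) $ i $ j) = (\<lambda>t. \<Sum>k. c k * t ^ k)"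
    using mexp_entry_sums[of A i j] by (auto simp: c_def sums_iff)
  have "(\<lambda>k. A ** ((1 / fact k) *\<^sub>R mpow (t *\<^sub>R A) k)) sums (A ** mexp (t *\<^sub>R A))"
    unfolding mexp_def
    by (rule bounded_linear.sums[OF bounded_linear_matrix_mult_right summable_sums[OF summable_mexp]])
  \<comment> \<open>The factor \<open>k + 1\<close> in \<open>diffs c k\<close> cancels against
    \<open>fact (k + 1)\<close>, and \<open>mpow A (k + 1)\<close> is \<open>A ** mpow A k\<close>;
    so the differentiated series is the series of \<open>A ** mexp (t *\<^sub>R A)\<close>.\<close>
  from bounded_linear.sums[OF bounded_linear_matrix_entry this, of i j]
  have "(\<lambda>k. diffs c k * t ^ k) sums ((A ** mexp (t *\<^sub>R A)) $ i $ j)"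
    by (rule sums_cong[THEN iffD1, rotated])
      (simp add: mpow_scaleR diffs_def c_def bounded_bilinear.scaleR_right[OF bounded_bilinear_matrix_mult]
        del: of_nat_Suc)
  then have "(\<Sum>k. diffs c k * t ^ k) = (A ** mexp (t *\<^sub>R A)) $ i $ j" by (simp add: sums_iff)
  then show "((\<lambda>t. mexp (t *\<^sub>R A) $ i $ j) has_vector_derivative (A ** mexp (t *\<^sub>R A)) $ i $ j) (at t)"
    unfolding eq
    using termdiffs_strong_converges_everywhere[OF sm, of t]
    by (simp add: has_real_derivative_iff_has_vector_derivative)
qed

lemma has_vector_derivative_mexp_apply:
  "((\<lambda>t. mexp (t *\<^sub>R (A :: real^'n^'n)) *v v) has_vector_derivative (A *v (mexp (t *\<^sub>R A) *v v))) (at t)"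
  using bounded_linear.has_vector_derivative[OF bounded_linear_matrix_apply has_vector_derivative_mexp]
  by (simp add: matrix_vector_mul_assoc)

lemma continuous_mexp: "continuous_on S (\<lambda>t. mexp (t *\<^sub>R (A :: real^'n^'n)))"
  using has_vector_derivative_continuous[OF has_vector_derivative_mexp]
  by (intro continuous_at_imp_continuous_on ballI)

section \<open>Decay of the flow of a Hurwitz matrix\<close>

text \<open>The integrating factor \<open>exp (- c * t)\<close> makes the product nonincreasing.
  Neither \<open>c\<close> nor \<open>f\<close> carries a sign condition: the lemma serves decay,
  growth and differences of unknown sign alike.\<close>

lemma differential_gronwall:
  fixes f f' :: "real \<Rightarrow> real"
  assumes "a \<le> b"
    and deriv: "\<And>t. t \<in> {a..b} \<Longrightarrow> (f has_real_derivative f' t) (at t within {a..b})"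
    and le: "\<And>t. t \<in> {a..b} \<Longrightarrow> f' t \<le> c * f t"
  shows "f b \<le> exp (c * (b - a)) * f a"
proof -
  let ?h = "\<lambda>t. f t * exp (- c * t)"
  have deriv': "(?h has_real_derivative (f' t - c * f t) * exp (- c * t)) (at t within {a..b})"
    if "t \<in> {a..b}" for t
    by (rule derivative_eq_intros deriv[OF that] refl | simp)+ (simp add: algebra_simps)
  have "f b * exp (- c * b) \<le> f a * exp (- c * a)"
  proof (rule DERIV_nonpos_imp_decreasing_open[of a b ?h])
    show "a \<le> b" by fact
    show "continuous_on {a..b} ?h" using deriv' by (rule DERIV_continuous_on)
    fix t assume t: "a < t" "t < b"
    have "(f' t - c * f t) * exp (- c * t) \<le> 0"
      using le[of t] t by (intro mult_nonpos_nonneg) auto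
    moreover have "(?h has_real_derivative (f' t - c * f t) * exp (- c * t)) (at t)"
      using deriv'[of t] t at_within_Icc_at[of a t b] by simp
    ultimately show "\<exists>y. (?h has_real_derivative y) (at t) \<and> y \<le> 0" by blast
  qed
  then have "f b * exp (- c * b) * exp (c * b) \<le> f a * exp (- c * a) * exp (c * b)"
    by (rule mult_right_mono) simp
  then show ?thesis by (simp add: mult.assoc algebra_simps flip: exp_add)
qed

text \<open>Once \<open>g\<close> stays below \<open>c * e'\<close>, the shifted function
  \<open>f - e'\<close> obeys the undisturbed inequality and is bounded by a decaying exponential,
  so \<open>f\<close> ends up below \<open>2 * e'\<close>.\<close>

lemma damped_tendsto_zero:
  fixes f f' g :: "real \<Rightarrow> real"
  assumes "c > 0" and pos: "\<And>t. 0 \<le> f t"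
    and deriv: "\<And>t. (f has_real_derivative f' t) (at t)"
    and le: "\<And>t. f' t \<le> - c * f t + g t" and g: "(g \<longlongrightarrow> 0) at_top"
  shows "(f \<longlongrightarrow> 0) at_top"
proof (rule tendstoI)
  fix e :: real assume "e > 0"
  define e' where "e' = e / 2"
  have e': "0 < e'" "0 < c * e'" using \<open>e > 0\<close> \<open>c > 0\<close> by (auto simp: e'_def)
  obtain s where s: "\<And>t. t \<ge> s \<Longrightarrow> \<bar>g t\<bar> < c * e'"
    using tendstoD[OF g e'(2)] by (auto simp: eventually_at_top_linorder)
  have bound: "f t - e' \<le> exp (- c * (t - s)) * (f s - e')" if "s \<le> t" for t
  proof (rule differential_gronwall[OF that, where f' = f'])
    show "f' r \<le> - c * (f r - e')" if "r \<in> {s..t}" for r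
      using le[of r] s[of r] that by (simp add: algebra_simps)
  qed (auto intro!: derivative_eq_intros has_field_derivative_at_within[OF deriv])
  have "filterlim (\<lambda>t. - c * (t - s)) at_bot at_top"
    unfolding filterlim_at_bot
  proof
    fix Z
    show "\<forall>\<^sub>F t in at_top. - c * (t - s) \<le> Z"
      using eventually_ge_at_top[of "s - Z / c"]
      by eventually_elim (use \<open>c > 0\<close> in \<open>simp add: field_simps\<close>)
  qed
  then have "((\<lambda>t. exp (- c * (t - s)) * (f s - e')) \<longlongrightarrow> 0) at_top"
    by (intro tendsto_mult_left_zero filterlim_compose[OF exp_at_bot])
  from tendstoD[OF this e'(1)] show "\<forall>\<^sub>F t in at_top. dist (f t) 0 < e"
    using eventually_ge_at_top[of s]
  proof eventually_elim
    case (elim t)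
    have "f t < e" using bound[OF elim(2)] elim(1) by (simp add: e'_def)
    then show ?case using pos[of t] by simp
  qed
qed

text \<open>The squared modulus of \<open>y\<close> is damped at rate \<open>- 2 * Re l\<close>.
  Young's inequality spends half of this on the cross term with \<open>f\<close> and leaves the rate
  \<open>c = - Re l\<close>.\<close>

lemma complex_ode_tendsto_zero:
  fixes y f :: "real \<Rightarrow> complex"
  assumes "Re l < 0" and deriv: "\<And>t. (y has_vector_derivative l * y t + f t) (at t)"
    and f: "(f \<longlongrightarrow> 0) at_top"
  shows "(y \<longlongrightarrow> 0) at_top"
proof -
  define c where "c = - Re l"
  have "c > 0" using assms by (simp add: c_def)
  have "((\<lambda>t. y t \<bullet> y t) \<longlongrightarrow> 0) at_top"
  proof (rule damped_tendsto_zero[OF \<open>c > 0\<close>])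
    show "((\<lambda>t. y t \<bullet> y t) has_real_derivative 2 * (y t \<bullet> (l * y t + f t))) (at t)" for t
      using bounded_bilinear.has_vector_derivative[OF bounded_bilinear_inner deriv deriv, of t]
      by (simp add: has_real_derivative_iff_has_vector_derivative inner_commute)
    show "2 * (y t \<bullet> (l * y t + f t)) \<le> - c * (y t \<bullet> y t) + (norm (f t))\<^sup>2 / c" for t
    proof -
      have "y t \<bullet> (l * y t) = - c * (y t \<bullet> y t)"
        by (simp add: inner_complex_def c_def algebra_simps)
      moreover have "2 * (y t \<bullet> f t) \<le> c * (y t \<bullet> y t) + (norm (f t))\<^sup>2 / c"
      proof -
        have "0 \<le> (norm (c *\<^sub>R y t - f t))\<^sup>2 / c" using \<open>c > 0\<close> by simp
        also have "\<dots> = c * (y t \<bullet> y t) - 2 * (y t \<bullet> f t) + (norm (f t))\<^sup>2 / c"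
          using \<open>c > 0\<close> unfolding power2_norm_eq_inner
          by (simp add: inner_diff_left inner_diff_right inner_commute field_simps power2_eq_square)
        finally show ?thesis by simp
      qed
      ultimately show ?thesis by (simp add: inner_add_right)
    qed
    show "((\<lambda>t. (norm (f t))\<^sup>2 / c) \<longlongrightarrow> 0) at_top"
      using tendsto_divide[OF tendsto_power[OF tendsto_norm_zero[OF f], of 2] tendsto_const[of c]]
        \<open>c > 0\<close> by simp
  qed auto
  then have "((\<lambda>t. sqrt (y t \<bullet> y t)) \<longlongrightarrow> sqrt 0) at_top" by (rule tendsto_real_sqrt)
  then have "((\<lambda>t. norm (y t)) \<longlongrightarrow> 0) at_top"
    by (simp only: norm_eq_sqrt_inner[symmetric] real_sqrt_zero)
  then show ?thesis by (rule tendsto_norm_zero_cancel)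
qed

section \<open>Decay on vectors annihilated by a product of linear factors\<close>

lemma cmat_mult: "cmat (X ** Y) = cmat X ** cmat Y"
  by (simp add: cmat_def matrix_matrix_mult_def vec_eq_iff)

lemma bounded_linear_cmat_apply: "bounded_linear (\<lambda>X::real^'n^'m. cmat X *v w)"
  unfolding linear_conv_bounded_linear[symmetric]
  by (rule linearI) (auto simp: cmat_def matrix_vector_mult_def vec_eq_iff sum.distrib
      sum_distrib_left algebra_simps scaleR_conv_of_real[where 'a=complex])

text \<open>The action of \<open>C - l I\<close>, kept as a function on vectors so that a product of
  such factors is a \<open>foldr\<close> over a list of roots.\<close>

definition linear_factor :: "complex^'n^'n \<Rightarrow> complex \<Rightarrow> complex^'n \<Rightarrow> complex^'n" where
  "linear_factor C l w = C *v w - l *s w"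

lemma matrix_vector_mult_vmult: "C *v (l *s w) = l *s (C *v (w :: complex^'n))"
  by (simp add: matrix_vector_mult_def vec_eq_iff sum_distrib_left mult_ac)

lemma linear_factor_commute: "linear_factor C l (linear_factor C k w) = linear_factor C k (linear_factor C l w)"
  by (simp add: linear_factor_def matrix_vector_mult_diff_distrib matrix_vector_mult_vmult
      vec_eq_iff algebra_simps)

lemma foldr_linear_factor_commute:
  "foldr (linear_factor C) ls (linear_factor C l w) = linear_factor C l (foldr (linear_factor C) ls w)"
  by (induction ls) (simp_all add: linear_factor_commute)

text \<open>Induction on the number of factors. The vector \<open>w' = (C - l I) w\<close> needs one
  factor less, so its trajectory tends to zero, and the trajectory of \<open>w\<close> solves the
  scalar equation with rate \<open>l\<close> forced by it, entry by entry. This handles repeated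
  roots without generalised eigenspaces.\<close>

lemma mexp_apply_tendsto_zero_of_annihilated:
  fixes F :: "real^'n^'n"
  assumes "hurwitz F" "foldr (linear_factor (cmat F)) ls w = 0"
  shows "((\<lambda>t. cmat (mexp (t *\<^sub>R F)) *v w) \<longlongrightarrow> 0) at_top"
  using assms(2)
proof (induction ls arbitrary: w)
  case Nil
  then show ?case by simp
next
  case (Cons l ls)
  let ?E = "\<lambda>t. cmat (mexp (t *\<^sub>R F))"
  define w' where "w' = linear_factor (cmat F) l w"
  have ann: "foldr (linear_factor (cmat F)) ls w' = 0"
    using Cons.prems by (simp add: w'_def foldr_linear_factor_commute)
  show ?case
  proof (cases "Re l < 0")
    case False
    have "cmat F *v foldr (linear_factor (cmat F)) ls w = l *s foldr (linear_factor (cmat F)) ls w"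
      using Cons.prems by (simp add: linear_factor_def[of _ l])
    then have "foldr (linear_factor (cmat F)) ls w = 0"
      using \<open>hurwitz F\<close> False unfolding hurwitz_def by blast
    then show ?thesis by (rule Cons.IH)
  next
    case True
    have deriv: "((\<lambda>t. ?E t *v w) has_vector_derivative l *s (?E t *v w) + ?E t *v w') (at t)" for t
    proof -
      have "((\<lambda>t. ?E t *v w) has_vector_derivative cmat (F ** mexp (t *\<^sub>R F)) *v w) (at t)"
        by (rule bounded_linear.has_vector_derivative[OF bounded_linear_cmat_apply
              has_vector_derivative_mexp])
      also have "cmat (F ** mexp (t *\<^sub>R F)) *v w = ?E t *v (cmat F *v w)"
        by (simp add: cmat_mult matrix_vector_mul_assoc flip: mexp_scaleR_commute)
      also have "cmat F *v w = l *s w + w'" by (simp add: w'_def linear_factor_def)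
      finally show ?thesis by (simp add: matrix_vector_right_distrib matrix_vector_mult_vmult)
    qed
    have "((\<lambda>t. (?E t *v w) $ i) \<longlongrightarrow> 0) at_top" for i
    proof (rule complex_ode_tendsto_zero[OF True])
      show "((\<lambda>t. (?E t *v w) $ i) has_vector_derivative l * (?E t *v w) $ i + (?E t *v w') $ i) (at t)" for t
        using bounded_linear.has_vector_derivative[OF bounded_linear_vec_nth[of i] deriv[of t]] by simp
      show "((\<lambda>t. (?E t *v w') $ i) \<longlongrightarrow> 0) at_top"
        using tendsto_vec_nth[OF Cons.IH[OF ann], of i] by simp
    qed
    then show ?thesis by (intro vec_tendstoI) simp
  qed
qed

text \<open>This is \<open>p(C) w\<close>, evaluated by Horner's rule. Acting on a single vector, it
  needs no polynomials with matrix values.\<close>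

definition poly_apply :: "complex^'n^'n \<Rightarrow> complex^'n \<Rightarrow> complex poly \<Rightarrow> complex^'n" where
  "poly_apply C w p = fold_coeffs (\<lambda>a acc. a *s w + C *v acc) p 0"

lemma poly_apply_0 [simp]: "poly_apply C w 0 = 0"
  by (simp add: poly_apply_def)

lemma poly_apply_pCons [simp]: "poly_apply C w (pCons a p) = a *s w + C *v poly_apply C w p"
  by (cases "p = 0 \<and> a = 0") (auto simp: poly_apply_def)

lemma poly_apply_add: "poly_apply C w (p + q) = poly_apply C w p + poly_apply C w q"
  by (induction p q rule: poly_induct2)
    (simp_all add: matrix_vector_right_distrib vector_sadd_rdistrib add_ac)

lemma poly_apply_smult: "poly_apply C w (smult c p) = c *s poly_apply C w p"
  by (induction p)
    (simp_all add: matrix_vector_right_distrib matrix_vector_mult_vmult vector_add_ldistrib)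

lemma poly_apply_linear_factor:
  "poly_apply C w ([:- l, 1:] * q) = linear_factor C l (poly_apply C w q)"
proof -
  have "[:- l, 1:] * q = smult (- l) q + pCons 0 q" by simp
  then have "poly_apply C w ([:- l, 1:] * q) = (- l) *s poly_apply C w q + poly_apply C w (pCons 0 q)"
    by (simp only: poly_apply_add poly_apply_smult)
  then show ?thesis by (simp add: linear_factor_def del: mult_pCons_left)
qed

lemma poly_apply_prod_list:
  "poly_apply C w (\<Prod>l\<leftarrow>ls. [:- l, 1:]) = foldr (linear_factor C) ls w"
  by (induction ls) (simp_all add: poly_apply_linear_factor one_pCons del: mult_pCons_left)

lemma poly_apply_monom: "poly_apply C w (monom a k) = a *s (((*v) C ^^ k) w)"
  by (induction k) (simp_all add: monom_0 monom_Suc matrix_vector_mult_vmult)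

lemma poly_apply_sum: "poly_apply C w (sum f K) = (\<Sum>k\<in>K. poly_apply C w (f k))"
  by (induction K rule: infinite_finite_induct) (simp_all add: poly_apply_add)

text \<open>The iterates \<open>w, C w, C (C w), ...\<close> either repeat or form an infinite,
  hence dependent, set in a finite-dimensional space. Either way a nontrivial relation among them is
  a polynomial; this stands in for Cayley-Hamilton.\<close>

lemma annihilating_poly_exists:
  fixes C :: "complex^'n^'n"
  shows "\<exists>p. p \<noteq> 0 \<and> poly_apply C w p = 0"
proof -
  define v where "v k = ((*v) C ^^ k) w" for k
  show ?thesis
  proof (cases "inj v")
    case False
    then obtain i j where "i \<noteq> j" "v i = v j" by (auto simp: inj_def)
    define p where "p = monom (1::complex) i + monom (- 1) j"
    have "coeff p i \<noteq> 0" using \<open>i \<noteq> j\<close> by (simp add: p_def)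
    then have "p \<noteq> 0" by auto
    moreover have "poly_apply C w p = 0"
      using \<open>v i = v j\<close> by (simp add: p_def poly_apply_add poly_apply_monom v_def)
    ultimately show ?thesis by blast
  next
    case True
    then have "infinite (range v)" by (simp add: finite_image_iff)
    then have "dependent (range v)" using independent_imp_finite by blast
    then obtain S a x where S: "finite S" "S \<subseteq> range v" "x \<in> S" "a x \<noteq> 0" "(\<Sum>x\<in>S. a x *\<^sub>R x) = 0"
      unfolding dependent_explicit by blast
    \<comment> \<open>The dependence is indexed by vectors. Pulling it back along the injective
      \<open>v\<close> gives each vector its own degree, so no coefficients merge and
      \<open>p\<close> is nonzero.\<close>
    define p where "p = (\<Sum>k\<in>v -` S. monom (complex_of_real (a (v k))) k)"
    have fin: "finite (v -` S)" using S(1) True by (rule finite_vimageI)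
    obtain k where k: "x = v k" using S by auto
    have "coeff p k = of_real (a x)"
      using fin S(3) k by (simp add: p_def coeff_sum)
    then have "p \<noteq> 0" using S(4) by auto
    moreover have "poly_apply C w p = 0"
    proof -
      have "complex_of_real r *s x = r *\<^sub>R x" for r and x :: "complex^'n"
        by (simp add: vec_eq_iff scaleR_conv_of_real[where 'a=complex])
      then have "poly_apply C w p = (\<Sum>k\<in>v -` S. a (v k) *\<^sub>R v k)"
        by (simp add: p_def poly_apply_sum poly_apply_monom flip: v_def)
      also have "\<dots> = (\<Sum>x\<in>v ` (v -` S). a x *\<^sub>R x)"
        by (subst sum.reindex) (auto intro: inj_on_subset[OF True])
      also have "v ` (v -` S) = S" using S(2) by auto
      finally show ?thesis using S(5) by simp
    qed
    ultimately show ?thesis by blast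
  qed
qed

lemma annihilating_factors_exist:
  fixes C :: "complex^'n^'n"
  shows "\<exists>ls. foldr (linear_factor C) ls w = 0"
proof -
  obtain p where p: "p \<noteq> 0" "poly_apply C w p = 0" using annihilating_poly_exists by blast
  obtain R where "p = smult (lead_coeff p) (\<Prod>x\<in>#R. [:- x, 1:])"
    using alg_closed_imp_factorization[OF p(1)] by blast
  moreover obtain ls where "mset ls = R" using ex_mset by blast
  ultimately have "p = smult (lead_coeff p) (\<Prod>x\<leftarrow>ls. [:- x, 1:])"
    by (metis mset_map prod_mset_prod_list)
  then have "lead_coeff p *s foldr (linear_factor C) ls w = 0"
    using p(2) by (metis poly_apply_prod_list poly_apply_smult)
  then show ?thesis using p(1) by (auto simp: vec_eq_iff)
qed

lemma hurwitz_mexp_tendsto_zero: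
  fixes F :: "real^'n^'n"
  assumes "hurwitz F"
  shows "((\<lambda>t. mexp (t *\<^sub>R F) *v x) \<longlongrightarrow> 0) at_top"
proof -
  define w where "w = (\<chi> i. complex_of_real (x $ i))"
  obtain ls where "foldr (linear_factor (cmat F)) ls w = 0" using annihilating_factors_exist by blast
  from mexp_apply_tendsto_zero_of_annihilated[OF assms this]
  have lim: "((\<lambda>t. Re ((cmat (mexp (t *\<^sub>R F)) *v w) $ i)) \<longlongrightarrow> 0) at_top" for i
    using tendsto_Re[OF tendsto_vec_nth] by fastforce
  have "Re ((cmat X *v w) $ i) = (X *v x) $ i" for X :: "real^'n^'n" and i
    by (simp add: cmat_def w_def matrix_vector_mult_def)
  with lim show ?thesis by (intro vec_tendstoI) simp
qed

section \<open>Lyapunov equation and sampled flow\<close>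

text \<open>Two separate vectors are used, not just the quadratic form, because the symmetry of
  \<open>P\<close> is itself derived from this identity.\<close>

lemma lyapunov_form:
  fixes F P :: "real^'n^'n"
  assumes "transpose F ** P + P ** F + M = 0"
  shows "x \<bullet> (P *v (F *v y)) + (F *v x) \<bullet> (P *v y) = - (x \<bullet> (M *v y))"
proof -
  have "(F *v x) \<bullet> (P *v y) = x \<bullet> (transpose F *v (P *v y))"
    by (simp add: inner_matrix_transpose[of _ "transpose F"] del: transpose_matrix_vector)
  then have "x \<bullet> (P *v (F *v y)) + (F *v x) \<bullet> (P *v y) + x \<bullet> (M *v y)
      = x \<bullet> ((transpose F ** P + P ** F + M) *v y)"
    by (simp add: matrix_vector_mult_add_rdistrib inner_add_right matrix_vector_mul_assoc
        del: transpose_matrix_vector)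
  then show ?thesis by (simp add: assms)
qed

lemma bilinear_form_derivative:
  fixes P :: "real^'n^'m"
  assumes "(a has_vector_derivative a') (at t within S)" "(b has_vector_derivative b') (at t within S)"
  shows "((\<lambda>t. a t \<bullet> (P *v b t)) has_real_derivative a t \<bullet> (P *v b') + a' \<bullet> (P *v b t)) (at t within S)"
  unfolding has_real_derivative_iff_has_vector_derivative
  by (intro bounded_bilinear.has_vector_derivative[OF bounded_bilinear_inner]
      bounded_linear.has_vector_derivative[OF matrix_vector_mul_bounded_linear] assms)

text \<open>Along the flow of a Hurwitz matrix the bilinear form of \<open>P\<close> tends to zero, so its value at
  time zero is recovered from its derivative, which is minus the form of \<open>M\<close>.\<close>

lemma lyapunov_solution_posdef:
  fixes F P M :: "real^'n^'n"
  assumes hurwitz: "hurwitz F" and M: "sym_posdef M"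
    and lyap: "transpose F ** P + P ** F + M = 0"
  shows "sym_posdef P"
proof -
  define E where "E x t = mexp (t *\<^sub>R F) *v x" for x :: "real^'n" and t
  have E0: "E x 0 = x" for x by (simp add: E_def mexp_zero)
  have E_lim: "(E x \<longlongrightarrow> 0) at_top" for x
    unfolding E_def by (rule hurwitz_mexp_tendsto_zero[OF hurwitz])
  have E_deriv: "(E x has_vector_derivative F *v E x t) (at t)" for x t
    unfolding E_def by (rule has_vector_derivative_mexp_apply)
  have form_deriv: "((\<lambda>t. E x t \<bullet> (P *v E y t)) has_real_derivative - (E x t \<bullet> (M *v E y t))) (at t)"
    for x y t
    using bilinear_form_derivative[OF E_deriv[of x t] E_deriv[of y t], of P] by (simp add: lyapunov_form[OF lyap])
  have form_lim: "((\<lambda>t. E x t \<bullet> (P *v E y t)) \<longlongrightarrow> 0) at_top" for x y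
  proof -
    have "((\<lambda>t. P *v E y t) \<longlongrightarrow> P *v 0) at_top"
      by (rule bounded_linear.tendsto[OF matrix_vector_mul_bounded_linear E_lim])
    from tendsto_inner[OF E_lim[of x] this] show ?thesis by simp
  qed
  have M_sym: "x \<bullet> (M *v y) = y \<bullet> (M *v x)" for x y
    using M by (metis inner_commute inner_matrix_transpose sym_posdef_def)
  \<comment> \<open>The antisymmetric part of the form is constant along the flow because
    \<open>M\<close> is symmetric, and its limit is zero.\<close>
  have P_sym: "x \<bullet> (P *v y) = y \<bullet> (P *v x)" for x y
  proof -
    let ?g = "\<lambda>t. E x t \<bullet> (P *v E y t) - E y t \<bullet> (P *v E x t)"
    have "(?g has_real_derivative 0) (at t)" for t
      using DERIV_diff[OF form_deriv[of x y t] form_deriv[of y x t]] M_sym[of "E x t" "E y t"] by simp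
    then have "?g t = ?g 0" for t using DERIV_isconst_all[of ?g t 0] by blast
    then have "(?g \<longlongrightarrow> ?g 0) at_top" by (intro tendsto_eventually always_eventually allI)
    moreover have "(?g \<longlongrightarrow> 0) at_top" using tendsto_diff[OF form_lim[of x y] form_lim[of y x]] by simp
    ultimately have "?g 0 = 0" using tendsto_unique[OF trivial_limit_at_top_linorder] by blast
    then show ?thesis by (simp add: E0)
  qed
  have "transpose P = P"
  proof -
    have "transpose P *v y = P *v y" for y
    proof (rule vector_eq_rdot[THEN iffD1, rule_format])
      fix z show "(transpose P *v y) \<bullet> z = (P *v y) \<bullet> z"
        using P_sym[of y z] inner_matrix_transpose[of y P z] by (metis inner_commute)
    qed
    then show ?thesis by (simp add: matrix_eq)
  qed
  \<comment> \<open>The quadratic form is nonincreasing along the flow and tends to zero, so its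
    initial value cannot be negative.\<close>
  moreover have psd: "0 \<le> x \<bullet> (P *v x)" for x
  proof -
    let ?g = "\<lambda>t. E x t \<bullet> (P *v E x t)"
    have nonpos: "- (y \<bullet> (M *v y)) \<le> 0" for y
      using M by (cases "y = 0") (auto simp: sym_posdef_def less_imp_le)
    have "?g t \<le> ?g 0" if "0 \<le> t" for t
      using form_deriv[of x x] nonpos by (intro DERIV_nonpos_imp_nonincreasing[OF that]) blast
    then have "\<forall>\<^sub>F t in at_top. ?g t \<le> ?g 0"
      using eventually_ge_at_top[of 0] by (rule eventually_mono[rotated])
    from tendsto_upperbound[OF form_lim this] show ?thesis by (simp add: E0)
  qed
  \<comment> \<open>Strictness: a null vector of the semidefinite \<open>P\<close> lies in its
    kernel, and there the Lyapunov equation leaves only the form of \<open>M\<close>.\<close>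
  moreover have "x \<bullet> (P *v x) \<noteq> 0" if "x \<noteq> 0" for x
  proof
    assume null: "x \<bullet> (P *v x) = 0"
    have "P *v x = 0" by (rule psd_null_vector[OF \<open>transpose P = P\<close> psd null])
    then have "x \<bullet> (P *v (F *v x)) = 0"
      by (simp add: inner_matrix_transpose \<open>transpose P = P\<close> del: transpose_matrix_vector)
    then have "x \<bullet> ((transpose F ** P + P ** F + M) *v x) = x \<bullet> (M *v x)"
      using \<open>P *v x = 0\<close>
      by (simp add: matrix_vector_mult_add_rdistrib inner_add_right flip: matrix_vector_mul_assoc)
    then have "x \<bullet> (M *v x) = 0" by (simp add: lyap)
    then show False using M \<open>x \<noteq> 0\<close> by (metis less_irrefl sym_posdef_def)
  qed
  ultimately show ?thesis by (simp add: sym_posdef_def order.strict_iff_order)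
qed

text \<open>The state after time \<open>r\<close> when the plant starts at \<open>v\<close> under
  the constant input \<open>K *v v\<close>. At \<open>r = delta\<close> it is one predictor step,
  which is why prediction is exact.\<close>

definition flow :: "real^'n^'n \<Rightarrow> real^'m^'n \<Rightarrow> real^'n^'m \<Rightarrow> real \<Rightarrow> real^'n \<Rightarrow> real^'n" where
  "flow A B K r v = A_disc A r *v v + B_disc A B r *v (K *v v)"

lemma pred_state_Suc_flow:
  "pred_state A B K delta y (Suc p) = flow A B K delta (pred_state A B K delta y p)"
  by (simp add: flow_def)

lemma flow_zero [simp]: "flow A B K 0 v = v"
  by (simp add: flow_def A_disc_def B_disc_def mexp_zero)

lemma mexp_apply_integrable: "(\<lambda>s. mexp (s *\<^sub>R (A::real^'n^'n)) *v w) integrable_on {a..b}"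
  by (rule integrable_continuous_real[OF
        bounded_linear.continuous_on[OF bounded_linear_matrix_apply continuous_mexp]])

text \<open>The integral itself has no closed form through an inverse, as \<open>A\<close> may be
  singular; its product with \<open>A\<close> always has one.\<close>

lemma mexp_mult_integral:
  fixes A :: "real^'n^'n"
  assumes "0 \<le> r"
  shows "A *v integral {0..r} (\<lambda>s. mexp (s *\<^sub>R A) *v w) = mexp (r *\<^sub>R A) *v w - w"
proof -
  have "((\<lambda>s. A *v (mexp (s *\<^sub>R A) *v w)) has_integral
      mexp (r *\<^sub>R A) *v w - mexp (0 *\<^sub>R A) *v w) {0..r}"
    using assms
    by (rule fundamental_theorem_of_calculus[OF _
          has_vector_derivative_at_within[OF has_vector_derivative_mexp_apply]])
  moreover have "((\<lambda>s. A *v (mexp (s *\<^sub>R A) *v w)) has_integral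
      A *v integral {0..r} (\<lambda>s. mexp (s *\<^sub>R A) *v w)) {0..r}"
    using has_integral_linear[OF integrable_integral[OF mexp_apply_integrable[of A w 0 r]]
        matrix_vector_mul_bounded_linear[of A]]
    by (simp add: o_def)
  ultimately have "A *v integral {0..r} (\<lambda>s. mexp (s *\<^sub>R A) *v w)
      = mexp (r *\<^sub>R A) *v w - mexp (0 *\<^sub>R A) *v w" by (rule has_integral_unique[rotated])
  then show ?thesis by (simp add: mexp_zero)
qed

lemma B_disc_apply:
  fixes A :: "real^'n^'n" and B :: "real^'m^'n"
  shows "B_disc A B r *v u = integral {0..r} (\<lambda>s. mexp (s *\<^sub>R A) *v (B *v u))"
proof -
  have "(\<lambda>s. mexp (s *\<^sub>R A) ** B) integrable_on {0..r}"
    by (rule integrable_continuous_real[OF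
          bounded_linear.continuous_on[OF bounded_linear_matrix_mult_left continuous_mexp]])
  from integral_linear[OF this bounded_linear_matrix_apply, of u]
  show ?thesis by (simp add: B_disc_def o_def matrix_vector_mul_assoc)
qed

text \<open>Since \<open>mexp (r *\<^sub>R A) *v v - v\<close> is also an integral of the
  exponential, the whole displacement is driven by \<open>A + B ** K\<close> at \<open>v\<close>.
  This is how the norm of that matrix enters the sampling condition.\<close>

lemma flow_eq_integral:
  fixes A :: "real^'n^'n"
  assumes "0 \<le> r"
  shows "flow A B K r v = v + integral {0..r} (\<lambda>s. mexp (s *\<^sub>R A) *v ((A + B ** K) *v v))"
proof -
  have "integral {0..r} (\<lambda>s. mexp (s *\<^sub>R A) *v ((A + B ** K) *v v))
      = integral {0..r} (\<lambda>s. mexp (s *\<^sub>R A) *v (A *v v)) + B_disc A B r *v (K *v v)"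
    by (simp add: B_disc_apply mexp_apply_integrable matrix_vector_right_distrib
        matrix_vector_mult_add_rdistrib integral_add flip: matrix_vector_mul_assoc)
  moreover have "integral {0..r} (\<lambda>s. mexp (s *\<^sub>R A) *v (A *v v)) = mexp (r *\<^sub>R A) *v v - v"
  proof -
    have "((\<lambda>s. A *v (mexp (s *\<^sub>R A) *v v)) has_integral
        mexp (r *\<^sub>R A) *v v - mexp (0 *\<^sub>R A) *v v) {0..r}"
      using assms
      by (rule fundamental_theorem_of_calculus[OF _
            has_vector_derivative_at_within[OF has_vector_derivative_mexp_apply]])
    then show ?thesis
      by (simp add: matrix_vector_mul_assoc mexp_scaleR_commute mexp_zero integral_unique)
  qed
  ultimately show ?thesis by (simp add: flow_def A_disc_def)
qed

lemma flow_ode: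
  fixes A :: "real^'n^'n"
  assumes "0 \<le> r"
  shows "A *v flow A B K r v + B *v (K *v v) = mexp (r *\<^sub>R A) *v ((A + B ** K) *v v)"
proof -
  have "A *v flow A B K r v = (A ** mexp (r *\<^sub>R A)) *v v + (mexp (r *\<^sub>R A) *v (B *v (K *v v)) - B *v (K *v v))"
    by (simp add: flow_def A_disc_def B_disc_apply matrix_vector_right_distrib mexp_mult_integral[OF assms]
        flip: matrix_vector_mul_assoc)
  then show ?thesis
    by (simp add: mexp_scaleR_commute[symmetric] matrix_vector_right_distrib
        matrix_vector_mult_add_rdistrib matrix_vector_mul_assoc[symmetric] del: matrix_vector_mul_assoc)
qed

text \<open>The derivative is taken within an interval of nonnegative times, where the integral
  formula for the displacement is valid.\<close>

lemma flow_has_vector_derivative: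
  fixes A :: "real^'n^'n"
  assumes "r \<in> {a..b}" "0 \<le> a"
  shows "((\<lambda>r. flow A B K r v) has_vector_derivative (A *v flow A B K r v + B *v (K *v v)))
    (at r within {a..b})"
proof -
  let ?w = "(A + B ** K) *v v"
  have "continuous_on {0..b} (\<lambda>s. mexp (s *\<^sub>R A) *v ?w)"
    by (rule bounded_linear.continuous_on[OF bounded_linear_matrix_apply continuous_mexp])
  then have "((\<lambda>r. integral {0..r} (\<lambda>s. mexp (s *\<^sub>R A) *v ?w)) has_vector_derivative
      mexp (r *\<^sub>R A) *v ?w) (at r within {0..b})"
    using assms by (intro integral_has_vector_derivative) auto
  then have "((\<lambda>r. v + integral {0..r} (\<lambda>s. mexp (s *\<^sub>R A) *v ?w)) has_vector_derivative
      mexp (r *\<^sub>R A) *v ?w) (at r within {0..b})"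
    by (intro derivative_eq_intros) auto
  then have "((\<lambda>r. v + integral {0..r} (\<lambda>s. mexp (s *\<^sub>R A) *v ?w)) has_vector_derivative
      mexp (r *\<^sub>R A) *v ?w) (at r within {a..b})"
    by (rule has_vector_derivative_within_subset) (use assms in auto)
  then have "((\<lambda>r. flow A B K r v) has_vector_derivative mexp (r *\<^sub>R A) *v ?w) (at r within {a..b})"
    by (rule has_vector_derivative_transform[rotated 2])
      (use assms in \<open>auto simp: flow_eq_integral\<close>)
  moreover have "0 \<le> r" using assms by simp
  ultimately show ?thesis by (simp add: flow_ode)
qed

text \<open>The squared norm has derivative \<open>2 * (y \<bullet> (A *v y))\<close>, so only the
  symmetric part of \<open>A\<close> matters; \<open>mu\<close> may well be negative.\<close>

lemma mexp_apply_growth: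
  fixes A :: "real^'n^'n"
  assumes mu: "\<And>x. x \<bullet> (A *v x) \<le> mu * (norm x)\<^sup>2" and "0 \<le> s"
  shows "norm (mexp (s *\<^sub>R A) *v w) \<le> exp (mu * s) * norm w"
proof -
  let ?y = "\<lambda>s. mexp (s *\<^sub>R A) *v w"
  have "?y s \<bullet> ?y s \<le> exp ((2 * mu) * (s - 0)) * (?y 0 \<bullet> ?y 0)"
  proof (rule differential_gronwall[OF \<open>0 \<le> s\<close>])
    fix t
    have "((\<lambda>s. ?y s \<bullet> ?y s) has_vector_derivative ?y t \<bullet> (A *v ?y t) + (A *v ?y t) \<bullet> ?y t) (at t within {0..s})"
      by (intro bounded_bilinear.has_vector_derivative[OF bounded_bilinear_inner]
          has_vector_derivative_at_within[OF has_vector_derivative_mexp_apply])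
    then show "((\<lambda>s. ?y s \<bullet> ?y s) has_real_derivative 2 * (?y t \<bullet> (A *v ?y t))) (at t within {0..s})"
      by (simp add: has_real_derivative_iff_has_vector_derivative inner_commute)
    show "2 * (?y t \<bullet> (A *v ?y t)) \<le> 2 * mu * (?y t \<bullet> ?y t)"
      using mu[of "?y t"] by (simp add: power2_norm_eq_inner)
  qed
  then have "(norm (?y s))\<^sup>2 \<le> (exp (mu * s) * norm w)\<^sup>2"
    by (simp add: power2_norm_eq_inner mexp_zero power_mult_distrib mult.assoc flip: exp_double)
  then show ?thesis by (rule power2_le_imp_le) simp
qed

lemma opnorm_bound: "norm (X *v v) \<le> opnorm X * norm v"
  unfolding opnorm_def by (rule onorm[OF matrix_vector_mul_bounded_linear])

lemma opnorm_nonneg: "0 \<le> opnorm X"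
  unfolding opnorm_def by (rule onorm_pos_le[OF matrix_vector_mul_bounded_linear])

lemma flow_deviation:
  fixes A :: "real^'n^'n"
  assumes mu: "\<And>x. x \<bullet> (A *v x) \<le> mu * (norm x)\<^sup>2"
    and theta: "0 \<le> theta"
    and samp_pos: "mu > 0 \<Longrightarrow> delta \<le> (1 / mu) * ln (theta * (mu / max (opnorm (A + B ** K)) 1) + 1)"
    and samp_nonpos: "mu \<le> 0 \<Longrightarrow> delta \<le> theta * (1 / max (opnorm (A + B ** K)) 1)"
    and r: "0 \<le> r" "r \<le> delta"
  shows "norm (v - flow A B K r v) \<le> theta * norm v"
proof -
  define c where "c = max (opnorm (A + B ** K)) 1"
  have c: "c > 0" "norm ((A + B ** K) *v v) \<le> c * norm v"
    using order_trans[OF opnorm_bound[of "A + B ** K" v] mult_right_mono[of _ c "norm v"]]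
    by (auto simp: c_def)
  \<comment> \<open>\<open>g\<close> bounds the growth of the exponential and \<open>G\<close> is
    its integral. With \<open>c\<close> the norm factor, the two branches of the sampling condition
    amount to \<open>G * c \<le> theta\<close> at \<open>r = delta\<close>.\<close>
  define g where "g s = (if mu > 0 then exp (mu * s) else 1)" for s
  define G where "G = (if mu > 0 then (exp (mu * r) - 1) / mu else r)"
  have g: "(g has_integral G) {0..r}"
  proof (cases "mu > 0")
    case True
    have "((\<lambda>s. exp (mu * s)) has_integral exp (mu * r) / mu - exp (mu * 0) / mu) {0..r}"
      using True r
      by (intro fundamental_theorem_of_calculus[where f = "\<lambda>s. exp (mu * s) / mu"])
        (auto intro!: derivative_eq_intros simp: has_real_derivative_iff_has_vector_derivative[symmetric])
    then show ?thesis using True by (simp add: g_def[abs_def] G_def diff_divide_distrib)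
  next
    case False
    then show ?thesis using has_integral_const_real[of "1::real" 0 r] r by (simp add: g_def[abs_def] G_def)
  qed
  have G: "G * c \<le> theta"
  proof (cases "mu > 0")
    case True
    have "mu * r \<le> ln (theta * (mu / c) + 1)"
      using samp_pos[OF True] r True mult_left_mono[of r "(1 / mu) * ln (theta * (mu / c) + 1)" mu]
      by (simp add: c_def)
    moreover have "0 < theta * (mu / c) + 1" using True theta c(1) by (intro add_nonneg_pos) auto
    ultimately have "exp (mu * r) \<le> theta * (mu / c) + 1" by (metis exp_le_cancel_iff exp_ln)
    then show ?thesis using True c(1) by (simp add: G_def field_simps)
  next
    case False
    then have "delta * c \<le> theta" using samp_nonpos c(1) by (simp add: field_simps flip: c_def)
    moreover have "r * c \<le> delta * c" using r c(1) by (intro mult_right_mono) auto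
    ultimately show ?thesis using False by (simp add: G_def)
  qed
  have "norm (v - flow A B K r v) = norm (integral {0..r} (\<lambda>s. mexp (s *\<^sub>R A) *v ((A + B ** K) *v v)))"
    by (simp add: flow_eq_integral[OF r(1)])
  also have "\<dots> \<le> integral {0..r} (\<lambda>s. g s * (c * norm v))"
  proof (rule integral_norm_bound_integral[OF mexp_apply_integrable])
    show "(\<lambda>s. g s * (c * norm v)) integrable_on {0..r}"
      using has_integral_mult_left[OF g] by (rule has_integral_integrable)
    fix s assume s: "s \<in> {0..r}"
    have "norm (mexp (s *\<^sub>R A) *v ((A + B ** K) *v v)) \<le> exp (mu * s) * norm ((A + B ** K) *v v)"
      using mexp_apply_growth[OF mu] s by auto
    also have "\<dots> \<le> g s * (c * norm v)"
      using c(2) s by (intro mult_mono) (auto simp: g_def mult_nonpos_nonneg)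
    finally show "norm (mexp (s *\<^sub>R A) *v ((A + B ** K) *v v)) \<le> g s * (c * norm v)" .
  qed
  also have "\<dots> = (G * c) * norm v"
    using integral_unique[OF g] by (simp add: mult.assoc)
  also have "\<dots> \<le> theta * norm v" using G by (rule mult_right_mono) simp
  finally show ?thesis .
qed

section \<open>Effect of disturbance and noise over one period\<close>

text \<open>The differential version is applied to the right-hand side of the hypothesis, which is
  differentiable although \<open>f\<close> is only continuous.\<close>

lemma integral_gronwall:
  fixes f :: "real \<Rightarrow> real"
  assumes "a \<le> b" "0 \<le> k" and cont: "continuous_on {a..b} f"
    and le: "\<And>t. t \<in> {a..b} \<Longrightarrow> f t \<le> c + k * integral {a..t} f"
  shows "f b \<le> c * exp (k * (b - a))"
proof -
  let ?y = "\<lambda>t. c + k * integral {a..t} f"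
  have "?y b \<le> exp (k * (b - a)) * ?y a"
  proof (rule differential_gronwall[OF \<open>a \<le> b\<close>])
    fix t assume t: "t \<in> {a..b}"
    show "(?y has_real_derivative k * f t) (at t within {a..b})"
      using integral_has_real_derivative[OF cont t] by (auto intro!: derivative_eq_intros)
    show "k * f t \<le> k * ?y t" using le[OF t] \<open>0 \<le> k\<close> by (rule mult_left_mono)
  qed
  then show ?thesis using le[of b] \<open>a \<le> b\<close> by (simp add: mult.commute)
qed

text \<open>\<open>X\<close> runs under the constant input \<open>v\<close> and a disturbance,
  \<open>G\<close> under \<open>v0\<close> and none. Their difference obeys a linear integral
  equation whose forcing is the input mismatch \<open>q\<close> plus the disturbance
  \<open>w\<close>.\<close>

lemma perturbed_segment_error:
  fixes A :: "real^'n^'n" and B :: "real^'m^'n"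
  assumes "a \<le> b"
    and sol: "\<And>t. t \<in> {a..b} \<Longrightarrow> ((\<lambda>s. A *v X s + B *v U s + D s) has_integral X t - X a) {a..t}"
    and G: "\<And>t. t \<in> {a..b} \<Longrightarrow> (G has_vector_derivative A *v G t + B *v v0) (at t within {a..b})"
    and U: "\<And>t. a \<le> t \<Longrightarrow> t < b \<Longrightarrow> U t = v"
    and D: "\<And>t. t \<in> {a..b} \<Longrightarrow> norm (D t) \<le> w" and q: "norm (B *v (v - v0)) \<le> q"
  shows "norm (X b - G b) \<le> (norm (X a - G a) + (b - a) * (q + w)) * exp (opnorm A * (b - a))"
proof -
  let ?e = "\<lambda>t. X t - G t"
  have "0 \<le> w" using D[of a] \<open>a \<le> b\<close> by (meson atLeastAtMost_iff norm_ge_zero order.trans order_refl)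
  have "0 \<le> q" using q norm_ge_zero order_trans by blast
  have contG: "continuous_on {a..b} G"
    using has_vector_derivative_continuous[OF G] by (auto simp: continuous_on_eq_continuous_within)
  have contX: "continuous_on {a..b} X"
  proof -
    have "(\<lambda>s. A *v X s + B *v U s + D s) integrable_on {a..b}"
      using sol[of b] \<open>a \<le> b\<close> by auto
    then have "continuous_on {a..b} (\<lambda>t. X a + integral {a..t} (\<lambda>s. A *v X s + B *v U s + D s))"
      by (intro continuous_intros indefinite_integral_continuous_1)
    then show ?thesis
      by (rule continuous_on_eq) (simp add: integral_unique[OF sol])
  qed
  have conte: "continuous_on {a..b} (\<lambda>t. norm (?e t))"
    by (intro continuous_intros contX contG)
  show ?thesis
  proof (rule integral_gronwall[OF \<open>a \<le> b\<close> opnorm_nonneg conte])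
    fix t assume t: "t \<in> {a..b}"
    have "((\<lambda>s. A *v G s + B *v v0) has_integral G t - G a) {a..t}"
      using t by (intro fundamental_theorem_of_calculus)
        (auto intro: has_vector_derivative_within_subset[OF G])
    then have "((\<lambda>s. (A *v X s + B *v U s + D s) - (A *v G s + B *v v0)) has_integral
        (X t - X a) - (G t - G a)) {a..t}"
      using sol[OF t] by (rule has_integral_diff[rotated])
    then have "((\<lambda>s. (A *v X s + B *v U s + D s) - (A *v G s + B *v v0)) has_integral ?e t - ?e a) {a..t}"
      by (simp add: algebra_simps)
    \<comment> \<open>At the right end \<open>b\<close> the input may already belong to the next
      packet; a single point does not change the integral.\<close>
    then have int: "((\<lambda>s. A *v ?e s + B *v (v - v0) + D s) has_integral ?e t - ?e a) {a..t}"
      by (rule has_integral_spike_finite[of "{b}", rotated 2])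
        (use t U in \<open>auto simp: matrix_vector_mult_diff_distrib\<close>)
    have conte': "continuous_on {a..t} (\<lambda>s. norm (?e s))"
      using conte by (rule continuous_on_subset) (use t in auto)
    have "norm (integral {a..t} (\<lambda>s. A *v ?e s + B *v (v - v0) + D s))
        \<le> integral {a..t} (\<lambda>s. opnorm A * norm (?e s) + (q + w))"
    proof (rule integral_norm_bound_integral)
      show "(\<lambda>s. opnorm A * norm (?e s) + (q + w)) integrable_on {a..t}"
        by (intro integrable_continuous_real continuous_intros conte')
      fix s assume s: "s \<in> {a..t}"
      have "norm (A *v ?e s + B *v (v - v0) + D s) \<le> norm (A *v ?e s) + norm (B *v (v - v0)) + norm (D s)"
        by (intro norm_triangle_mono order_refl)
      also have "\<dots> \<le> opnorm A * norm (?e s) + q + w"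
        using s t by (intro add_mono opnorm_bound q D) auto
      finally show "norm (A *v ?e s + B *v (v - v0) + D s) \<le> opnorm A * norm (?e s) + (q + w)" by simp
    qed (use int in auto)
    also have "\<dots> = opnorm A * integral {a..t} (\<lambda>s. norm (?e s)) + (t - a) * (q + w)"
      using t by (subst integral_add)
        (auto intro!: integrable_continuous_real continuous_intros conte' simp: mult.commute)
    finally have "norm (?e t - ?e a) \<le> opnorm A * integral {a..t} (\<lambda>s. norm (?e s)) + (t - a) * (q + w)"
      using integral_unique[OF int] by simp
    moreover have "(t - a) * (q + w) \<le> (b - a) * (q + w)"
      using t \<open>0 \<le> q\<close> \<open>0 \<le> w\<close> by (intro mult_right_mono) auto
    moreover have "norm (?e t) \<le> norm (?e a) + norm (?e t - ?e a)"
      using norm_triangle_ineq[of "?e a" "?e t - ?e a"] by simp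
    ultimately show "norm (?e t) \<le> norm (?e a) + (b - a) * (q + w) + opnorm A * integral {a..t} (\<lambda>s. norm (?e s))"
      by linarith
  qed
qed

section \<open>Predictor bounds and the nominal trajectory of one period\<close>

lemma pred_state_diff:
  "pred_state A B K delta y p - pred_state A B K delta y' p = pred_state A B K delta (y - y') p"
proof (induction p)
  case (Suc p)
  show ?case by (simp add: matrix_vector_mult_diff_distrib flip: Suc)
qed simp

lemma pred_state_bound: "\<exists>c\<ge>1. \<forall>p<h. \<forall>y. norm (pred_state A B K delta y p) \<le> c * norm y"
proof -
  define c where "c = max 1 (opnorm (A_disc A delta) + opnorm (B_disc A B delta) * opnorm K)"
  have "c \<ge> 1" by (simp add: c_def)
  have step: "norm (A_disc A delta *v v + B_disc A B delta *v (K *v v)) \<le> c * norm v" for v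
  proof -
    have "norm (B_disc A B delta *v (K *v v)) \<le> opnorm (B_disc A B delta) * (opnorm K * norm v)"
      by (rule order_trans[OF opnorm_bound mult_left_mono[OF opnorm_bound opnorm_nonneg]])
    then have "norm (A_disc A delta *v v + B_disc A B delta *v (K *v v))
        \<le> (opnorm (A_disc A delta) + opnorm (B_disc A B delta) * opnorm K) * norm v"
      using norm_triangle_ineq[of "A_disc A delta *v v" "B_disc A B delta *v (K *v v)"]
        opnorm_bound[of "A_disc A delta" v] by (simp add: algebra_simps)
    also have "\<dots> \<le> c * norm v" by (intro mult_right_mono) (auto simp: c_def)
    finally show ?thesis .
  qed
  have bound: "norm (pred_state A B K delta y p) \<le> c ^ p * norm y" for y p
  proof (induction p)
    case (Suc p)
    have "norm (pred_state A B K delta y (Suc p)) \<le> c * norm (pred_state A B K delta y p)"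
      using step by simp
    also have "\<dots> \<le> c * (c ^ p * norm y)" using Suc \<open>c \<ge> 1\<close> by (intro mult_left_mono) auto
    finally show ?case by simp
  qed simp
  have "norm (pred_state A B K delta y p) \<le> c ^ h * norm y" if "p < h" for p y
    using bound[of y p] mult_right_mono[OF power_increasing[of p h c], of "norm y"] that \<open>c \<ge> 1\<close> by simp
  moreover have "c ^ h \<ge> 1" using \<open>c \<ge> 1\<close> by simp
  ultimately show ?thesis by blast
qed

text \<open>The index used by \<open>ctrl_input\<close>, with time counted from the last success, so
  that every period can be treated as starting at zero.\<close>

definition packet_index :: "real \<Rightarrow> nat \<Rightarrow> real \<Rightarrow> nat" where
  "packet_index delta h s = min (h - 1) (nat \<lfloor>s / delta\<rfloor>)"

text \<open>The noise-free, undisturbed state at time \<open>s\<close> after a success in state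
  \<open>v\<close>. The flow is restarted at each predictor state, and the capped index lets the
  last piece run on under the last input.\<close>

definition nominal :: "real^'n^'n \<Rightarrow> real^'m^'n \<Rightarrow> real^'n^'m \<Rightarrow> real \<Rightarrow> nat \<Rightarrow> real^'n \<Rightarrow> real \<Rightarrow> real^'n" where
  "nominal A B K delta h v s = (let p = packet_index delta h s in
     flow A B K (s - real p * delta) (pred_state A B K delta v p))"

lemma packet_index_cases:
  assumes "delta > 0" "h \<ge> 1" "0 \<le> s"
  obtains "packet_index delta h s < h" "real (packet_index delta h s) * delta \<le> s"
    "s < real h * delta \<Longrightarrow> s < (real (packet_index delta h s) + 1) * delta"
    "real h * delta \<le> s \<Longrightarrow> packet_index delta h s = h - 1"
proof
  let ?q = "nat \<lfloor>s / delta\<rfloor>"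
  have q: "real ?q \<le> s / delta" "s / delta < real ?q + 1"
    using assms by (simp_all add: of_nat_floor)
  then have q': "real ?q * delta \<le> s" "s < (real ?q + 1) * delta"
    using assms(1) by (simp_all only: pos_le_divide_eq pos_divide_less_eq)
  show "packet_index delta h s < h" using assms by (auto simp: packet_index_def)
  have "packet_index delta h s \<le> ?q" by (simp add: packet_index_def)
  then have "real (packet_index delta h s) * delta \<le> real ?q * delta"
    using assms by (intro mult_right_mono of_nat_mono) auto
  then show "real (packet_index delta h s) * delta \<le> s" using q' by linarith
  show "s < (real (packet_index delta h s) + 1) * delta" if "s < real h * delta"
  proof -
    have "s / delta < real h" using that assms by (simp add: field_simps)
    then have "?q < h" using q by linarith
    then have "packet_index delta h s = ?q" by (auto simp: packet_index_def)
    then show ?thesis using q' by simp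
  qed
  show "packet_index delta h s = h - 1" if "real h * delta \<le> s"
  proof -
    have "real h \<le> s / delta" using that assms by (simp add: field_simps)
    then have "h \<le> ?q" by (simp add: le_nat_floor)
    then show ?thesis by (auto simp: packet_index_def)
  qed
qed

lemma packet_index_eq:
  assumes "delta > 0" "p < h" "real p * delta \<le> s" "p = h - 1 \<or> s < (real p + 1) * delta"
  shows "packet_index delta h s = p"
proof -
  have "real p \<le> s / delta" using assms by (simp add: field_simps)
  then have "p \<le> nat \<lfloor>s / delta\<rfloor>" by (simp add: le_nat_floor)
  moreover have "nat \<lfloor>s / delta\<rfloor> \<le> p" if "p \<noteq> h - 1"
  proof -
    have "s / delta < real p + 1" using that assms by (simp add: field_simps)
    then show ?thesis using \<open>real p \<le> s / delta\<close> by linarith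
  qed
  ultimately show ?thesis
    using assms(2) by (cases "p = h - 1") (auto simp: packet_index_def min_def)
qed

definition perturbed_period where
  "perturbed_period A B K delta h X U D n w L \<longleftrightarrow>
    (\<forall>a t. 0 \<le> a \<longrightarrow> a \<le> t \<longrightarrow> t \<le> L \<longrightarrow>
        ((\<lambda>s. A *v X s + B *v U s + D s) has_integral X t - X a) {a..t}) \<and>
    (\<forall>t. 0 \<le> t \<longrightarrow> t < L \<longrightarrow>
        U t = K *v pred_state A B K delta (X 0 + n) (packet_index delta h t)) \<and>
    (\<forall>t. 0 \<le> t \<longrightarrow> t \<le> L \<longrightarrow> norm (D t) \<le> w) \<and> norm n \<le> w"

text \<open>The constant is chosen before the trajectory and depends on the period only through
  \<open>Lmax\<close>, so one \<open>C\<close> serves all periods. The error is carried from packet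
  to packet, of which there are at most \<open>h\<close>.\<close>

lemma perturbed_period_error:
  fixes A :: "real^'n^'n" and B :: "real^'m^'n" and K :: "real^'n^'m"
  assumes "delta > 0" "h \<ge> 1"
  shows "\<exists>C\<ge>0. \<forall>X U D n w L t. L \<le> Lmax \<longrightarrow> perturbed_period A B K delta h X U D n w L \<longrightarrow>
    0 \<le> t \<longrightarrow> t \<le> L \<longrightarrow> norm (X t - nominal A B K delta h (X 0) t) \<le> C * w"
proof -
  obtain c where c: "c \<ge> 1" "\<And>p y. p < h \<Longrightarrow> norm (pred_state A B K delta y p) \<le> c * norm y"
    using pred_state_bound[of h A B K delta] by auto
  \<comment> \<open>By linearity the wrong initial sample shifts the predicted states by the
    prediction started at the noise value; \<open>k * w\<close> bounds the resulting mismatch in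
    \<open>B u\<close>.\<close>
  define k where "k = opnorm B * (opnorm K * c)"
  have k: "k \<ge> 0" using c by (simp add: k_def opnorm_nonneg)
  define E where "E = exp (opnorm A * \<bar>Lmax\<bar>)"
  have E: "E \<ge> 1" by (simp add: E_def opnorm_nonneg)
  define c0 where "c0 = \<bar>Lmax\<bar> * (k + 1)"
  have c0: "c0 \<ge> 0" using k by (simp add: c0_def)
  have main: "norm (X t - nominal A B K delta h (X 0) t) \<le> (real h * c0 * E ^ h) * w"
    if L: "0 \<le> L" "L \<le> Lmax"
      and sol: "\<And>a t. 0 \<le> a \<Longrightarrow> a \<le> t \<Longrightarrow> t \<le> L \<Longrightarrow>
        ((\<lambda>s. A *v X s + B *v U s + D s) has_integral X t - X a) {a..t}"
      and U: "\<And>t. 0 \<le> t \<Longrightarrow> t < L \<Longrightarrow> U t = K *v pred_state A B K delta (X 0 + n) (packet_index delta h t)"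
      and D: "\<And>t. 0 \<le> t \<Longrightarrow> t \<le> L \<Longrightarrow> norm (D t) \<le> w" and n: "norm n \<le> w"
      and t: "0 \<le> t" "t \<le> L"
    for X U D n w L t
  proof -
    let ?a = "\<lambda>p. pred_state A B K delta (X 0) p"
    have w: "w \<ge> 0" using n norm_ge_zero order_trans by blast
    have seg: "norm (X t - flow A B K (t - real p * delta) (?a p)) \<le> (norm (X (real p * delta) - ?a p) + c0 * w) * E"
      if p: "p < h" "real p * delta \<le> t" "p = h - 1 \<or> t \<le> (real p + 1) * delta" and t: "t \<le> L" for p t
    proof -
      let ?s = "real p * delta"
      let ?v = "K *v pred_state A B K delta (X 0 + n) p"
      have s: "0 \<le> ?s" using assms by simp
      have "norm (X t - flow A B K (t - ?s) (?a p))
          \<le> (norm (X ?s - flow A B K (?s - ?s) (?a p)) + (t - ?s) * (k * w + w)) * exp (opnorm A * (t - ?s))"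
      proof (rule perturbed_segment_error[OF p(2), where v = ?v and v0 = "K *v ?a p"])
        show "((\<lambda>s. A *v X s + B *v U s + D s) has_integral X r - X ?s) {?s..r}" if "r \<in> {?s..t}" for r
          using that s t by (intro sol) auto
        show "((\<lambda>r. flow A B K (r - ?s) (?a p)) has_vector_derivative
            A *v flow A B K (r - ?s) (?a p) + B *v (K *v ?a p)) (at r within {?s..t})"
          if "r \<in> {?s..t}" for r
        proof -
          have "((\<lambda>r. r - ?s) has_vector_derivative 1) (at r within {?s..t})"
            by (auto intro!: derivative_eq_intros)
          moreover have "((\<lambda>r. flow A B K r (?a p)) has_vector_derivative
            A *v flow A B K (r - ?s) (?a p) + B *v (K *v ?a p)) (at (r - ?s) within (\<lambda>r. r - ?s) ` {?s..t})"
            using flow_has_vector_derivative[of "r - ?s" 0 "t - ?s" A B K "?a p"] that p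
            by (simp add: image_diff_atLeastAtMost)
          ultimately show ?thesis
            by (rule vector_diff_chain_within[unfolded o_def, THEN has_vector_derivative_eq_rhs]) simp
        qed
        show "U r = ?v" if "?s \<le> r" "r < t" for r
        proof -
          have "packet_index delta h r = p"
            using p that assms by (intro packet_index_eq) auto
          then show ?thesis using U[of r] that s t by simp
        qed
        show "norm (D r) \<le> w" if "r \<in> {?s..t}" for r using that s t by (intro D) auto
        have "?v - K *v ?a p = K *v pred_state A B K delta n p"
          by (simp add: pred_state_diff flip: matrix_vector_mult_diff_distrib)
        then have "norm (B *v (?v - K *v ?a p)) \<le> opnorm B * (opnorm K * norm (pred_state A B K delta n p))"
          by (simp add: order_trans[OF opnorm_bound mult_left_mono[OF opnorm_bound opnorm_nonneg]])
        also have "\<dots> \<le> opnorm B * (opnorm K * (c * w))"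
          using c p n by (intro mult_left_mono opnorm_nonneg order_trans[OF c(2)]) auto
        finally show "norm (B *v (?v - K *v ?a p)) \<le> k * w" by (simp add: k_def mult.assoc)
      qed
      also have "\<dots> \<le> (norm (X ?s - ?a p) + c0 * w) * E"
      proof (rule mult_mono)
        have "(t - ?s) * (k * w + w) \<le> \<bar>Lmax\<bar> * (k * w + w)"
          using s t L k w by (intro mult_right_mono) auto
        then show "norm (X ?s - flow A B K (?s - ?s) (?a p)) + (t - ?s) * (k * w + w) \<le> norm (X ?s - ?a p) + c0 * w"
          by (simp add: c0_def algebra_simps)
        show "exp (opnorm A * (t - ?s)) \<le> E"
          unfolding E_def exp_le_cancel_iff using s t L by (intro mult_left_mono opnorm_nonneg) auto
      qed (use c0 w in auto)
      finally show ?thesis .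
    qed
    have err: "norm (X t - flow A B K (t - real p * delta) (?a p)) \<le> (real p + 1) * c0 * E ^ (p + 1) * w"
      if "p < h" "real p * delta \<le> t" "p = h - 1 \<or> t \<le> (real p + 1) * delta" "t \<le> L" for p t
      using that
    proof (induction p arbitrary: t)
      case 0
      then show ?case using seg[OF 0] by (simp add: mult_ac)
    next
      case (Suc p)
      let ?s = "real (Suc p) * delta"
      \<comment> \<open>The end of packet \<open>p\<close> is the start of packet
        \<open>p + 1\<close>: the nominal flow over \<open>delta\<close> from one predicted state is
        the next predicted state, so no new error arises at the junction.\<close>
      have "norm (X ?s - flow A B K (?s - real p * delta) (?a p)) \<le> (real p + 1) * c0 * E ^ (p + 1) * w"
        using Suc.prems assms by (intro Suc.IH) (auto simp: algebra_simps)
      then have "norm (X ?s - ?a (Suc p)) \<le> (real p + 1) * c0 * E ^ (p + 1) * w"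
        unfolding pred_state_Suc_flow by (simp add: algebra_simps)
      moreover have "c0 * w \<le> c0 * E ^ (p + 1) * w"
        using mult_right_mono[OF mult_left_mono[OF one_le_power[OF E, of "p + 1"] c0] w] by simp
      ultimately have "norm (X ?s - ?a (Suc p)) + c0 * w \<le> (real p + 2) * c0 * E ^ (p + 1) * w"
        by (simp add: algebra_simps)
      then have "(norm (X ?s - ?a (Suc p)) + c0 * w) * E \<le> (real p + 2) * c0 * E ^ (p + 1) * w * E"
        using E by (intro mult_right_mono) auto
      then show ?case using seg[OF Suc.prems] by (simp add: algebra_simps)
    qed
    obtain p where p: "p = packet_index delta h t" "p < h" "real p * delta \<le> t"
      "t < real h * delta \<Longrightarrow> t < (real p + 1) * delta" "real h * delta \<le> t \<Longrightarrow> p = h - 1"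
      using packet_index_cases[OF assms t(1)] by metis
    have "norm (X t - nominal A B K delta h (X 0) t) \<le> (real p + 1) * c0 * E ^ (p + 1) * w"
      using err[OF p(2,3) _ t(2)] p(4,5) unfolding nominal_def Let_def p(1)[symmetric] by force
    also have "\<dots> \<le> real h * c0 * E ^ h * w"
      using p(2) E c0 w by (intro mult_mono mult_right_mono power_increasing) auto
    finally show ?thesis .
  qed
  show ?thesis
  proof (intro exI[of _ "real h * c0 * E ^ h"] conjI allI impI, goal_cases)
    case (2 X U D n w L t)
    then show ?case unfolding perturbed_period_def by (intro main[of L X U D n w t]) auto
  qed (use c0 E in simp)
qed

section \<open>Contraction of the nominal period map\<close>

lemma exp_mult_exp_mult: "exp a * (exp b * c) = exp (a + b) * (c :: real)"
  by (simp add: exp_add)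

text \<open>The eigenvalues enter only through bounds on quadratic forms, and the sampling condition
  only through \<open>deviation\<close>.\<close>

locale predictive_loop =
  fixes A :: "real^'n^'n" and B :: "real^'m^'n" and K :: "real^'n^'m" and M P :: "real^'n^'n"
    and delta sigma alpha1 alpha2 gamma1 gamma2 omega1 omega2 :: real and h :: nat
  assumes P_sym: "transpose P = P"
    and lyap: "transpose (A + B ** K) ** P + P ** (A + B ** K) + M = 0"
    and P_lower: "\<And>x. alpha1 * (norm x)\<^sup>2 \<le> x \<bullet> (P *v x)"
    and P_upper: "\<And>x. x \<bullet> (P *v x) \<le> alpha2 * (norm x)\<^sup>2"
    and M_lower: "\<And>x. gamma1 * (norm x)\<^sup>2 \<le> x \<bullet> (M *v x)"
    and gamma2: "gamma2 = opnorm (2 *\<^sub>R (P ** B ** K))"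
    and pos: "0 < alpha1" "0 < alpha2" "0 < sigma" "0 < gamma1 - sigma * gamma2" "0 < delta" "1 \<le> h"
    and omega1: "omega1 = (gamma1 - sigma * gamma2) / (2 * alpha2)"
    and omega2: "omega2 = gamma2 * (2 + sigma) / alpha1"
    and deviation: "\<And>r v. 0 \<le> r \<Longrightarrow> r \<le> delta \<Longrightarrow>
        norm (v - flow A B K r v) \<le> sigma / (1 + sigma) * norm v"
begin

abbreviation V :: "real^'n \<Rightarrow> real" where "V x \<equiv> x \<bullet> (P *v x)"

lemma V_nonneg: "0 \<le> V x"
  using P_lower[of x] pos by (meson mult_nonneg_nonneg order_trans less_imp_le zero_le_power2)

lemma gamma2_nonneg: "0 \<le> gamma2"
  by (simp add: gamma2 opnorm_nonneg)

lemma omega_pos: "0 < omega1" "0 \<le> omega2"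
  using pos gamma2_nonneg by (auto simp: omega1 omega2)

text \<open>The held input is split as \<open>K\<close> applied to the current state plus
  \<open>K\<close> applied to \<open>v\<close> minus the current state. The first part gives the
  Hurwitz dynamics and \<open>M\<close>, the second the matrix whose norm is
  \<open>gamma2\<close>.\<close>

lemma V_flow_derivative:
  assumes "r \<in> {a..b}" "0 \<le> a"
  shows "((\<lambda>r. V (flow A B K r v)) has_real_derivative
      - (flow A B K r v \<bullet> (M *v flow A B K r v))
      + flow A B K r v \<bullet> ((2 *\<^sub>R (P ** B ** K)) *v (v - flow A B K r v))) (at r within {a..b})"
proof -
  let ?g = "flow A B K r v"
  let ?F = "A + B ** K"
  let ?q = "B *v (K *v (v - ?g))"
  have ode: "A *v ?g + B *v (K *v v) = ?F *v ?g + ?q"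
    by (simp add: matrix_vector_mult_add_rdistrib matrix_vector_mult_diff_distrib
        flip: matrix_vector_mul_assoc)
  have symP: "x \<bullet> (P *v y) = y \<bullet> (P *v x)" for x y
    using inner_matrix_transpose[of x P y] by (simp add: P_sym inner_commute)
  have "?g \<bullet> (P *v (?F *v ?g + ?q)) + (?F *v ?g + ?q) \<bullet> (P *v ?g)
      = (?g \<bullet> (P *v (?F *v ?g)) + (?F *v ?g) \<bullet> (P *v ?g)) + 2 * (?g \<bullet> (P *v ?q))"
    using symP[of ?q ?g] by (simp add: matrix_vector_right_distrib inner_add_left inner_add_right)
  also have "\<dots> = - (?g \<bullet> (M *v ?g)) + ?g \<bullet> ((2 *\<^sub>R (P ** B ** K)) *v (v - ?g))"
    unfolding lyapunov_form[OF lyap]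
    by (simp flip: scaleR_matrix_vector_assoc matrix_vector_mul_assoc)
  finally show ?thesis
    using bilinear_form_derivative[OF flow_has_vector_derivative[OF assms, of A B K v]
        flow_has_vector_derivative[OF assms, of A B K v], of P]
    unfolding ode by simp
qed

lemma V_flow_derivative_le:
  "- (x \<bullet> (M *v x)) + x \<bullet> ((2 *\<^sub>R (P ** B ** K)) *v e) \<le> - gamma1 * (norm x)\<^sup>2 + gamma2 * (norm x * norm e)"
proof -
  have "x \<bullet> ((2 *\<^sub>R (P ** B ** K)) *v e) \<le> norm x * norm ((2 *\<^sub>R (P ** B ** K)) *v e)"
    by (rule norm_cauchy_schwarz)
  also have "\<dots> \<le> norm x * (gamma2 * norm e)"
    unfolding gamma2 by (intro mult_left_mono opnorm_bound norm_ge_zero)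
  finally show ?thesis using M_lower[of x] by (simp add: mult_ac)
qed

text \<open>The bound relative to the start \<open>v\<close> becomes one relative to the current
  state; the ratio \<open>sigma / (1 + sigma)\<close> is the one for which the triangle inequality
  returns exactly \<open>sigma\<close>.\<close>

lemma deviation_current:
  assumes "0 \<le> r" "r \<le> delta"
  shows "norm (v - flow A B K r v) \<le> sigma * norm (flow A B K r v)"
proof -
  let ?g = "flow A B K r v"
  have "norm v \<le> norm (v - ?g) + norm ?g" using norm_triangle_ineq[of "v - ?g" ?g] by simp
  then have "sigma / (1 + sigma) * norm v \<le> sigma / (1 + sigma) * (norm (v - ?g) + norm ?g)"
    using pos by (intro mult_left_mono) auto
  then have "norm (v - ?g) \<le> sigma / (1 + sigma) * (norm (v - ?g) + norm ?g)"
    using deviation[OF assms, of v] by linarith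
  then have "norm (v - ?g) * (1 + sigma) \<le> sigma * (norm (v - ?g) + norm ?g)"
    using pos by (simp add: pos_le_divide_eq)
  then show ?thesis by (simp add: algebra_simps)
qed

lemma V_flow_decay:
  assumes "0 \<le> r" "r \<le> delta"
  shows "V (flow A B K r v) \<le> exp (- omega1 * r) * V v"
proof -
  have "V (flow A B K r v) \<le> exp (- omega1 * (r - 0)) * V (flow A B K 0 v)"
  proof (rule differential_gronwall[OF \<open>0 \<le> r\<close> V_flow_derivative])
    fix t assume t: "t \<in> {0..r}"
    let ?g = "flow A B K t v"
    have "gamma2 * (norm ?g * norm (v - ?g)) \<le> gamma2 * (norm ?g * (sigma * norm ?g))"
      using t assms by (intro mult_left_mono deviation_current gamma2_nonneg) auto
    then have "- (?g \<bullet> (M *v ?g)) + ?g \<bullet> ((2 *\<^sub>R (P ** B ** K)) *v (v - ?g))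
        \<le> - (gamma1 - sigma * gamma2) * (norm ?g)\<^sup>2"
      using V_flow_derivative_le[of ?g "v - ?g"] by (simp add: algebra_simps power2_eq_square)
    also have "\<dots> \<le> - omega1 * V ?g"
    proof -
      have "omega1 * V ?g \<le> omega1 * (alpha2 * (norm ?g)\<^sup>2)"
        using P_upper omega_pos by (intro mult_left_mono) auto
      also have "\<dots> = (gamma1 - sigma * gamma2) * (norm ?g)\<^sup>2 / 2"
        using pos by (simp add: omega1)
      also have "\<dots> \<le> (gamma1 - sigma * gamma2) * (norm ?g)\<^sup>2"
        using pos by simp
      finally show ?thesis by (simp only: mult_minus_left neg_le_iff_le)
    qed
    finally show "- (?g \<bullet> (M *v ?g)) + ?g \<bullet> ((2 *\<^sub>R (P ** B ** K)) *v (v - ?g)) \<le> - omega1 * V ?g" .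
  qed auto
  then show ?thesis by simp
qed

text \<open>Here the input is stale. The derivative of \<open>V\<close> is bounded by
  \<open>a\<close> times the current value plus \<open>b\<close> times the value at
  \<open>delta\<close>, and as the comparison function never falls below that value, the excess
  \<open>?h\<close> over it satisfies \<open>?h' \<le> a * ?h\<close> with
  \<open>?h delta = 0\<close>.\<close>

lemma V_flow_growth:
  assumes "delta \<le> r"
  shows "V (flow A B K r v) \<le> exp (omega2 * (r - delta)) * V (flow A B K delta v)"
proof -
  let ?V0 = "V (flow A B K delta v)"
  \<comment> \<open>The cross term \<open>(1 + sigma)\<close> times the product of the current norm
    and the norm at \<open>delta\<close> is shared equally between both squares; the
    \<open>1\<close> in \<open>a\<close> is the current state's own share of the error.\<close>
  define a where "a = gamma2 / alpha1 * (1 + (1 + sigma) / 2)"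
  define b where "b = gamma2 / alpha1 * ((1 + sigma) / 2)"
  have ab: "a + b = omega2" "0 \<le> b"
    using pos gamma2_nonneg by (auto simp: a_def b_def omega2 field_simps)
  let ?Z = "\<lambda>t. exp (omega2 * (t - delta)) * ?V0"
  let ?h = "\<lambda>t. V (flow A B K t v) - ?Z t"
  let ?V' = "\<lambda>t. - (flow A B K t v \<bullet> (M *v flow A B K t v))
      + flow A B K t v \<bullet> ((2 *\<^sub>R (P ** B ** K)) *v (v - flow A B K t v))"
  have "?h r \<le> exp (a * (r - delta)) * ?h delta"
  proof (rule differential_gronwall[OF assms])
    fix t assume t: "t \<in> {delta..r}"
    let ?g = "flow A B K t v"
    let ?n0 = "norm (flow A B K delta v)"
    show "(?h has_real_derivative ?V' t - omega2 * ?Z t) (at t within {delta..r})"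
    proof (rule DERIV_diff)
      show "((\<lambda>t. V (flow A B K t v)) has_real_derivative ?V' t) (at t within {delta..r})"
        using pos by (intro V_flow_derivative[OF t]) simp
      show "(?Z has_real_derivative omega2 * ?Z t) (at t within {delta..r})"
        by (auto intro!: derivative_eq_intros)
    qed
    have "norm v \<le> norm (v - flow A B K delta v) + ?n0"
      using norm_triangle_ineq[of "v - flow A B K delta v" "flow A B K delta v"] by simp
    then have "norm v \<le> (1 + sigma) * ?n0"
      using deviation_current[of delta v] pos by (simp add: algebra_simps)
    then have "norm (v - ?g) \<le> (1 + sigma) * ?n0 + norm ?g"
      using norm_triangle_ineq4[of v ?g] by linarith
    then have "norm ?g * norm (v - ?g) \<le> norm ?g * ((1 + sigma) * ?n0 + norm ?g)"
      by (intro mult_left_mono) auto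
    also have "\<dots> \<le> (1 + (1 + sigma) / 2) * (norm ?g)\<^sup>2 + ((1 + sigma) / 2) * ?n0\<^sup>2"
    proof -
      have "norm ?g * ?n0 \<le> ((norm ?g)\<^sup>2 + ?n0\<^sup>2) / 2"
        using sum_squares_bound[of "norm ?g" ?n0] by simp
      then have "(1 + sigma) * (norm ?g * ?n0) \<le> (1 + sigma) * (((norm ?g)\<^sup>2 + ?n0\<^sup>2) / 2)"
        using pos by (intro mult_left_mono) auto
      then show ?thesis by (simp add: field_simps power2_eq_square)
    qed
    also have "\<dots> \<le> (1 + (1 + sigma) / 2) * (V ?g / alpha1) + ((1 + sigma) / 2) * (?V0 / alpha1)"
      using P_lower[of ?g] P_lower[of "flow A B K delta v"] pos
      by (intro add_mono mult_left_mono) (auto simp: pos_le_divide_eq mult.commute)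
    finally have "gamma2 * (norm ?g * norm (v - ?g))
        \<le> gamma2 * ((1 + (1 + sigma) / 2) * (V ?g / alpha1) + ((1 + sigma) / 2) * (?V0 / alpha1))"
      using gamma2_nonneg by (rule mult_left_mono)
    also have "\<dots> = a * V ?g + b * ?V0"
      using pos(1) by (simp add: a_def b_def field_simps)
    finally have "gamma2 * (norm ?g * norm (v - ?g)) \<le> a * V ?g + b * ?V0" .
    moreover have "0 \<le> sigma * gamma2" using pos gamma2_nonneg by simp
    then have "- gamma1 * (norm ?g)\<^sup>2 \<le> 0" using pos by simp
    ultimately have "?V' t \<le> a * V ?g + b * ?V0"
      using V_flow_derivative_le[of ?g "v - ?g"] by linarith
    moreover have "b * ?V0 \<le> b * ?Z t"
    proof (rule mult_left_mono[OF _ ab(2)])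
      have "1 \<le> exp (omega2 * (t - delta))" using t omega_pos by simp
      then show "?V0 \<le> ?Z t" using mult_right_mono[of 1 _ ?V0] V_nonneg by simp
    qed
    ultimately show "?V' t - omega2 * ?Z t \<le> a * ?h t"
      unfolding ab(1)[symmetric] by (simp add: algebra_simps)
  qed
  then show ?thesis by simp
qed

lemma V_pred_state_decay: "V (pred_state A B K delta v p) \<le> exp (- omega1 * (real p * delta)) * V v"
proof (induction p)
  case (Suc p)
  have "V (pred_state A B K delta v (Suc p)) \<le> exp (- omega1 * delta) * V (pred_state A B K delta v p)"
    unfolding pred_state_Suc_flow using pos by (intro V_flow_decay) auto
  also have "\<dots> \<le> exp (- omega1 * delta) * (exp (- omega1 * (real p * delta)) * V v)"
    using Suc by (intro mult_left_mono) auto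
  also have "\<dots> = exp (- omega1 * (real (Suc p) * delta)) * V v"
    unfolding exp_mult_exp_mult by (simp add: algebra_simps)
  finally show ?case .
qed simp

lemma V_nominal_decay:
  assumes "0 \<le> s" "s \<le> real h * delta"
  shows "V (nominal A B K delta h v s) \<le> exp (- omega1 * s) * V v"
proof -
  obtain p where p: "p = packet_index delta h s" "p < h" "real p * delta \<le> s"
    "s < real h * delta \<Longrightarrow> s < (real p + 1) * delta" "real h * delta \<le> s \<Longrightarrow> p = h - 1"
    using packet_index_cases[OF pos(5,6) assms(1)] by metis
  have "s - real p * delta \<le> delta"
  proof (cases "s < real h * delta")
    case True
    then show ?thesis using p(4) by (simp add: algebra_simps)
  next
    case False
    then have "p = h - 1" "s = real h * delta" using p(5) assms by auto
    then show ?thesis using pos by (simp add: of_nat_diff algebra_simps)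
  qed
  then have "V (nominal A B K delta h v s)
      \<le> exp (- omega1 * (s - real p * delta)) * V (pred_state A B K delta v p)"
    unfolding nominal_def Let_def p(1)[symmetric] using p(3) by (intro V_flow_decay) auto
  also have "\<dots> \<le> exp (- omega1 * (s - real p * delta)) * (exp (- omega1 * (real p * delta)) * V v)"
    by (intro mult_left_mono V_pred_state_decay) auto
  also have "\<dots> = exp (- omega1 * s) * V v"
    unfolding exp_mult_exp_mult by (simp add: algebra_simps)
  finally show ?thesis .
qed

text \<open>Growth is counted from \<open>h * delta\<close>, not from the start
  \<open>(h - 1) * delta\<close> of the last packet: during its first \<open>delta\<close> time
  units the last input still produces decay.\<close>

lemma V_nominal_growth:
  assumes "real h * delta \<le> s"
  shows "V (nominal A B K delta h v s) \<le> exp (- omega1 * (real h * delta) + omega2 * (s - real h * delta)) * V v"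
proof -
  have "0 \<le> s" using assms pos by (meson mult_nonneg_nonneg of_nat_0_le_iff less_imp_le order_trans)
  have p: "packet_index delta h s = h - 1"
    using packet_index_cases[OF pos(5,6) \<open>0 \<le> s\<close>] assms by metis
  have h: "Suc (h - 1) = h" using pos by simp
  have r: "s - real (h - 1) * delta - delta = s - real h * delta"
    using pos by (simp add: of_nat_diff algebra_simps)
  have "V (nominal A B K delta h v s)
      \<le> exp (omega2 * (s - real (h - 1) * delta - delta)) * V (flow A B K delta (pred_state A B K delta v (h - 1)))"
    unfolding nominal_def Let_def p using assms r by (intro V_flow_growth) linarith
  also have "\<dots> = exp (omega2 * (s - real h * delta)) * V (pred_state A B K delta v h)"
    unfolding r using pred_state_Suc_flow[of A B K delta v "h - 1"] h by simp
  also have "\<dots> \<le> exp (omega2 * (s - real h * delta)) * (exp (- omega1 * (real h * delta)) * V v)"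
    by (intro mult_left_mono V_pred_state_decay) auto
  also have "\<dots> = exp (- omega1 * (real h * delta) + omega2 * (s - real h * delta)) * V v"
    unfolding exp_mult_exp_mult by (simp add: algebra_simps)
  finally show ?thesis .
qed

lemma V_nominal_bounded:
  assumes "0 \<le> s" "s \<le> Lmax"
  shows "V (nominal A B K delta h v s) \<le> exp (omega2 * Lmax) * V v"
proof (cases "s \<le> real h * delta")
  case True
  have "- omega1 * s \<le> omega2 * Lmax"
    using assms omega_pos by (meson less_imp_le mult_nonneg_nonneg mult_nonpos_nonneg neg_le_0_iff_le order_trans)
  then have "exp (- omega1 * s) * V v \<le> exp (omega2 * Lmax) * V v"
    by (intro mult_right_mono V_nonneg) simp
  then show ?thesis using V_nominal_decay[OF assms(1) True, of v] by linarith
next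
  case False
  have "0 \<le> real h * delta" using pos by simp
  then have "omega2 * (s - real h * delta) \<le> omega2 * Lmax"
    using assms omega_pos by (intro mult_left_mono) auto
  moreover have "0 \<le> omega1 * (real h * delta)" using omega_pos pos by simp
  ultimately have "exp (- omega1 * (real h * delta) + omega2 * (s - real h * delta)) * V v \<le> exp (omega2 * Lmax) * V v"
    by (intro mult_right_mono V_nonneg) simp
  then show ?thesis using V_nominal_growth[of s v] False by linarith
qed

text \<open>The horizon condition is exactly what makes the decay over \<open>h\<delta>\<close> beat the growth over the
  remaining part of a period of maximal length.\<close>

lemma V_nominal_contraction:
  assumes "0 < Lmin" and horizon: "real h * delta > omega2 / (omega1 + omega2) * Lmax"
  shows "\<exists>l. 0 < l \<and> l < 1 \<and> (\<forall>s v. Lmin \<le> s \<longrightarrow> s \<le> Lmax \<longrightarrow> V (nominal A B K delta h v s) \<le> l * V v)"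
proof -
  \<comment> \<open>\<open>- c\<close> is the exponent in the growth bound for a period of length
    \<open>Lmax\<close>; the horizon condition says that it is negative.\<close>
  define c where "c = (omega1 + omega2) * (real h * delta) - omega2 * Lmax"
  have "c > 0"
    using horizon omega_pos by (simp add: c_def field_simps)
  \<comment> \<open>The first entry covers periods that end within the horizon, where
    \<open>Lmin\<close> guarantees some decay; the second covers those that outlast it.\<close>
  define l where "l = max (exp (- omega1 * Lmin)) (exp (- c))"
  have l: "0 < l" "l < 1"
    using assms omega_pos \<open>c > 0\<close> by (auto simp: l_def less_max_iff_disj)
  have "V (nominal A B K delta h v s) \<le> l * V v" if s: "Lmin \<le> s" "s \<le> Lmax" for s v
  proof -
    have "\<exists>k. k \<le> l \<and> V (nominal A B K delta h v s) \<le> k * V v"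
    proof (cases "s \<le> real h * delta")
      case True
      have "exp (- omega1 * s) \<le> l" using s omega_pos by (auto simp: l_def le_max_iff_disj)
      then show ?thesis using V_nominal_decay[of s v] True s assms by auto
    next
      case False
      have "omega2 * s \<le> omega2 * Lmax" using s omega_pos by (intro mult_left_mono) auto
      then have "- omega1 * (real h * delta) + omega2 * (s - real h * delta) \<le> - c"
        by (simp add: c_def algebra_simps)
      then have "exp (- omega1 * (real h * delta) + omega2 * (s - real h * delta)) \<le> l"
        unfolding l_def by (intro max.coboundedI2) simp
      then show ?thesis using V_nominal_growth[of s v] False by auto
    qed
    then show ?thesis using mult_right_mono[OF _ V_nonneg] order_trans by blast
  qed
  then show ?thesis using l by blast
qed

text \<open>Young's inequality for the inner product of \<open>P\<close>, from
  \<open>V (c *\<^sub>R x - y) \<ge> 0\<close>. A small \<open>c\<close> makes the factor on the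
  nominal part close to one, at the expense of the error.\<close>

lemma V_add_le:
  assumes "0 < c"
  shows "V (x + y) \<le> (1 + c) * V x + (1 + 1 / c) * V y"
proof -
  have symP: "y \<bullet> (P *v x) = x \<bullet> (P *v y)"
    using inner_matrix_transpose[of x P y] by (simp add: P_sym inner_commute)
  have "0 \<le> V (c *\<^sub>R x - y) / c" using V_nonneg[of "c *\<^sub>R x - y"] assms by simp
  also have "\<dots> = c * V x - 2 * (x \<bullet> (P *v y)) + V y / c"
    using assms symP
    by (simp add: matrix_vector_mult_diff_distrib matrix_vector_mult_scaleR inner_diff_left
        inner_diff_right field_simps)
  finally show ?thesis
    using symP by (simp add: matrix_vector_right_distrib inner_add_left inner_add_right algebra_simps)
qed

end

section \<open>Successful transmissions under denial of service\<close>

locale dos_attack =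
  fixes I :: "nat set" and ht tau :: "nat \<Rightarrow> real" and Delta eta tauD kappa T Q :: real
  assumes Delta_pos: "Delta > 0"
    and dos: "dos_signal I ht tau"
    and freq: "eta \<ge> 0" "tauD > 0" "dos_frequency I ht eta tauD"
    and dur: "kappa \<ge> 0" "T > 1" "dos_duration I ht tau kappa T"
    and rate: "1 / T + Delta / tauD < 1"
    and Q: "Q = (kappa + eta * Delta) / (1 - 1 / T - Delta / tauD)"
begin

lemma Q_nonneg: "0 \<le> Q"
  using freq dur rate Delta_pos by (simp add: Q)

lemma dos_set_measurable: "dos_set I ht tau \<in> sets borel"
  unfolding dos_set_def dos_H_def by (intro sets.countable_UN') auto

text \<open>If all attempts in \<open>[s, t)\<close> fail, then every instant of \<open>[s, t)\<close> is jammed or at most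
  \<open>\<Delta>\<close> after the end of a pulse that starts in \<open>[s, t)\<close>.\<close>

lemma failure_burst_length:
  fixes p q :: nat
  assumes s: "0 \<le> s" "s \<le> real p * Delta" "real p * Delta \<le> s + Delta" and "p \<le> q"
    and start: "s = real p * Delta \<or> (\<exists>i\<in>I. ht i = s)"
    and fails: "\<And>j. p \<le> j \<Longrightarrow> j \<le> q \<Longrightarrow> real j * Delta \<in> dos_set I ht tau"
    and lower: "\<And>i j. i \<in> I \<Longrightarrow> p \<le> j \<Longrightarrow> j \<le> q \<Longrightarrow> real j * Delta \<in> dos_H ht tau i \<Longrightarrow> s \<le> ht i"
  shows "real (q + 1) * Delta - s \<le> Q"
proof -
  define t where "t = real (q + 1) * Delta"
  have pq: "real p * Delta \<le> real q * Delta" using \<open>p \<le> q\<close> Delta_pos by simp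
  have t: "t = real q * Delta + Delta" by (simp add: t_def algebra_simps)
  have "s < t" using s pq Delta_pos t by linarith
  have tau: "0 \<le> tau i" if "i \<in> I" for i using dos that by (simp add: dos_signal_def)
  define J where "J = dos_trans I ht s t"
  have J: "finite J" "real (card J) \<le> eta + (t - s) / tauD"
    using freq(3) s(1) \<open>s < t\<close> unfolding J_def dos_frequency_def by auto
  define X where "X = dos_set I ht tau \<inter> {s..t}"
  define W where "W = (\<Union>i\<in>J. {ht i + tau i ..< ht i + tau i + Delta})"
  have cover: "{s..<t} \<subseteq> X \<union> W"
  proof
    fix r assume r: "r \<in> {s..<t}"
    have "\<exists>i\<in>J. ht i \<le> r \<and> r < ht i + tau i + Delta"
    \<comment> \<open>Before the first failed attempt, the pulse starting at \<open>s\<close> does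
      the job, as that attempt is at most \<open>Delta\<close> after \<open>s\<close>.\<close>
    proof (cases "r < real p * Delta")
      case True
      then obtain i where "i \<in> I" "ht i = s" using start r by auto
      then show ?thesis
        using True s r tau[of i] \<open>s < t\<close> by (intro bexI[of _ i]) (auto simp: J_def dos_trans_def)
    next
      case False
      \<comment> \<open>The last attempt not after \<open>r\<close>. It fails, and the pulse that
        hits it ends no earlier than this attempt, hence less than \<open>Delta\<close> before
        \<open>r\<close>.\<close>
      define j where "j = nat \<lfloor>r / Delta\<rfloor>"
      have "0 \<le> r" using r s by simp
      have "real j \<le> r / Delta" "r / Delta < real j + 1"
        using \<open>0 \<le> r\<close> Delta_pos by (simp_all add: j_def of_nat_floor)
      then have j: "real j * Delta \<le> r" "r < (real j + 1) * Delta"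
        using Delta_pos by (simp_all only: pos_le_divide_eq pos_divide_less_eq)
      have "real p * Delta < (real j + 1) * Delta" using False j by linarith
      then have "p \<le> j" using Delta_pos by simp
      have "real j * Delta < real (q + 1) * Delta" using j r by (simp add: t_def)
      then have "j \<le> q" using Delta_pos by simp
      obtain i where i: "i \<in> I" "real j * Delta \<in> dos_H ht tau i"
        using fails[OF \<open>p \<le> j\<close> \<open>j \<le> q\<close>] by (auto simp: dos_set_def)
      have "s \<le> ht i" by (rule lower[OF i(1) \<open>p \<le> j\<close> \<open>j \<le> q\<close> i(2)])
      moreover have "ht i \<le> real j * Delta" "real j * Delta \<le> ht i + tau i"
        using i tau[of i] by (auto simp: dos_H_def)
      ultimately show ?thesis
        using i(1) j r by (intro bexI[of _ i]) (auto simp: J_def dos_trans_def algebra_simps)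
    qed
    then obtain i where i: "i \<in> J" "ht i \<le> r" "r < ht i + tau i + Delta" by blast
    show "r \<in> X \<union> W"
    proof (cases "r < ht i + tau i")
      case True
      then have "r \<in> dos_set I ht tau"
        using i by (auto simp: dos_set_def dos_H_def J_def dos_trans_def)
      then show ?thesis using r by (auto simp: X_def)
    next
      case False
      then show ?thesis using i by (auto simp: W_def)
    qed
  qed
  have Icc: "{a..b} \<in> fmeasurable lborel" for a b :: real
    by (rule fmeasurableI) (auto simp: emeasure_lborel_Icc_eq)
  have X_meas: "X \<in> fmeasurable lborel"
    unfolding X_def
    by (rule fmeasurableI2[OF Icc Int_lower2]) (simp add: sets.Int[OF dos_set_measurable])
  have W_meas: "W \<in> fmeasurable lborel"
    unfolding W_def
  proof (rule fmeasurable.finite_UN[OF J(1)])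
    show "{ht i + tau i ..< ht i + tau i + Delta} \<in> fmeasurable lborel" for i
      by (rule fmeasurableI2[OF Icc[of "ht i + tau i" "ht i + tau i + Delta"]]) auto
  qed
  have "t - s = measure lborel {s..<t}" using \<open>s < t\<close> by simp
  also have "\<dots> \<le> measure lborel (X \<union> W)"
    using cover X_meas W_meas by (intro measure_mono_fmeasurable) auto
  also have "\<dots> \<le> measure lborel X + measure lborel W"
    using X_meas W_meas by (intro measure_Un_le) (auto simp: fmeasurableD)
  also have "measure lborel W \<le> (\<Sum>i\<in>J. measure lborel {ht i + tau i ..< ht i + tau i + Delta})"
    unfolding W_def using J(1) by (intro measure_UNION_le) auto
  also have "\<dots> = real (card J) * Delta" using Delta_pos by simp
  also have "\<dots> \<le> (eta + (t - s) / tauD) * Delta"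
    using J(2) Delta_pos by (intro mult_right_mono) auto
  also have "measure lborel X \<le> kappa + (t - s) / T"
    using dur(3) s(1) \<open>s < t\<close> by (simp add: X_def dos_duration_def)
  finally have "t - s \<le> kappa + (t - s) / T + (eta + (t - s) / tauD) * Delta" by simp
  \<comment> \<open>The burst length occurs on both sides; the rate condition makes its collected
    coefficient positive, and dividing by it yields \<open>Q\<close>.\<close>
  then have "(t - s) * (1 - 1 / T - Delta / tauD) \<le> kappa + eta * Delta"
    by (simp add: algebra_simps)
  then show ?thesis
    using rate unfolding Q t_def[symmetric] by (simp add: pos_le_divide_eq)
qed

lemma success_exists: "\<exists>k::nat. real k * Delta \<notin> dos_set I ht tau"
proof (rule ccontr)
  assume "\<not> ?thesis"
  then have bound: "real (q + 1) * Delta - 0 \<le> Q" for q :: nat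
    using dos Delta_pos by (intro failure_burst_length[of 0 0 q]) (auto simp: dos_signal_def)
  obtain q :: nat where "Q / Delta < real q" using reals_Archimedean2 by blast
  then have "Q < real q * Delta" using Delta_pos by (simp only: pos_divide_less_eq)
  then show False using bound[of q] Delta_pos by (simp add: algebra_simps)
qed

text \<open>Attempt \<open>k\<close> succeeds and pulses are intervals, so every pulse hitting a
  later attempt starts after it. The burst is measured from the earliest such start, which may be as
  late as attempt \<open>k + 1\<close>; this is the additional \<open>Delta\<close>.\<close>

lemma next_success:
  assumes k: "real k * Delta \<notin> dos_set I ht tau"
  shows "\<exists>k'>k. real k' * Delta \<notin> dos_set I ht tau \<and> (real k' - real k) * Delta \<le> Q + Delta"
proof (rule ccontr)
  assume none: "\<not> ?thesis"
  \<comment> \<open>The last attempt within \<open>Q + Delta\<close> of attempt \<open>k\<close>;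
    attempt \<open>q + 1\<close> already lies beyond, which contradicts the bound on the
    burst.\<close>
  define q where "q = k + nat \<lfloor>(Q + Delta) / Delta\<rfloor>"
  have "0 \<le> (Q + Delta) / Delta" using Q_nonneg Delta_pos by simp
  then have "real q - real k \<le> (Q + Delta) / Delta" "(Q + Delta) / Delta < real q - real k + 1"
    by (simp_all add: q_def of_nat_floor)
  then have q: "(real q - real k) * Delta \<le> Q + Delta" "Q + Delta < (real q - real k + 1) * Delta"
    using Delta_pos by (simp_all only: pos_le_divide_eq pos_divide_less_eq)
  have "1 \<le> (Q + Delta) / Delta" using Q_nonneg Delta_pos by simp
  then have "k + 1 \<le> q" by (simp add: q_def le_nat_floor)
  have fails: "real j * Delta \<in> dos_set I ht tau" if "k + 1 \<le> j" "j \<le> q" for j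
  proof -
    have "(real j - real k) * Delta \<le> (real q - real k) * Delta"
      using that Delta_pos by (intro mult_right_mono) auto
    then have "(real j - real k) * Delta \<le> Q + Delta" using q(1) by linarith
    moreover have "k < j" using that by simp
    ultimately show ?thesis using none by blast
  qed
  define J where "J = {i\<in>I. real k * Delta < ht i \<and> ht i < real (q + 1) * Delta}"
  have inJ: "i \<in> J" if i: "i \<in> I" "real j * Delta \<in> dos_H ht tau i" and j: "k + 1 \<le> j" "j \<le> q" for i j
  proof -
    have kj: "real k * Delta < real j * Delta" using j Delta_pos by simp
    have jq: "real j * Delta < real (q + 1) * Delta" using j Delta_pos by simp
    have "real k * Delta \<notin> dos_H ht tau i" using k i by (auto simp: dos_set_def)
    then have "real k * Delta < ht i" using i kj by (auto simp: dos_H_def)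
    moreover have "ht i \<le> real j * Delta" using i by (auto simp: dos_H_def)
    ultimately show ?thesis using i jq by (simp add: J_def)
  qed
  obtain i0 where i0: "i0 \<in> I" "real (k + 1) * Delta \<in> dos_H ht tau i0"
    using fails[of "k + 1"] \<open>k + 1 \<le> q\<close> by (auto simp: dos_set_def)
  then have "i0 \<in> J" using inJ \<open>k + 1 \<le> q\<close> by blast
  have "real k * Delta \<le> real (q + 1) * Delta"
    using \<open>k + 1 \<le> q\<close> Delta_pos by (intro mult_right_mono) auto
  then have "finite (dos_trans I ht (real k * Delta) (real (q + 1) * Delta))"
    using freq(3) Delta_pos unfolding dos_frequency_def by (meson mult_nonneg_nonneg less_imp_le of_nat_0_le_iff)
  then have "finite J" by (rule rev_finite_subset) (auto simp: J_def dos_trans_def)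
  \<comment> \<open>The frequency assumption makes \<open>J\<close> finite, so an earliest pulse
    exists.\<close>
  define s where "s = Min (ht ` J)"
  have "s \<in> ht ` J" unfolding s_def using \<open>finite J\<close> \<open>i0 \<in> J\<close> by (intro Min_in) auto
  then obtain i1 where i1: "i1 \<in> J" "s = ht i1" by auto
  have s_le: "s \<le> ht i" if "i \<in> J" for i unfolding s_def using \<open>finite J\<close> that by simp
  have "s \<le> real (k + 1) * Delta" using s_le[OF \<open>i0 \<in> J\<close>] i0 by (auto simp: dos_H_def)
  have "real k * Delta < s" using i1 by (simp add: J_def)
  have "real (q + 1) * Delta - s \<le> Q"
  proof (rule failure_burst_length[where p = "k + 1"])
    show "0 \<le> s" using \<open>real k * Delta < s\<close> Delta_pos by (meson less_imp_le mult_nonneg_nonneg of_nat_0_le_iff order_trans)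
    show "real (k + 1) * Delta \<le> s + Delta" using \<open>real k * Delta < s\<close> by (simp add: algebra_simps)
    show "s = real (k + 1) * Delta \<or> (\<exists>i\<in>I. ht i = s)" using i1 by (auto simp: J_def)
    show "s \<le> ht i" if "i \<in> I" "k + 1 \<le> j" "j \<le> q" "real j * Delta \<in> dos_H ht tau i" for i j
      using inJ that by (intro s_le) blast
  qed fact+
  then show False using \<open>s \<le> real (k + 1) * Delta\<close> q(2) by (simp add: algebra_simps)
qed

abbreviation "successes \<equiv> {k::nat. real k * Delta \<notin> dos_set I ht tau}"

lemma infinite_successes: "infinite successes"
proof
  assume fin: "finite successes"
  moreover have "successes \<noteq> {}" using success_exists by blast
  ultimately have "Max successes \<in> successes" by (rule Max_in)
  then obtain k' where "k' > Max successes" "k' \<in> successes" using next_success by blast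
  then show False using Max_ge[OF fin] by fastforce
qed

lemma succ_time_nonneg: "0 \<le> succ_time I ht tau Delta m"
  using Delta_pos by (simp add: succ_time_def)

lemma succ_time_gap:
  "Delta \<le> succ_time I ht tau Delta (Suc m) - succ_time I ht tau Delta m"
  "succ_time I ht tau Delta (Suc m) - succ_time I ht tau Delta m \<le> Q + Delta"
proof -
  let ?e = "enumerate successes"
  have diff: "succ_time I ht tau Delta (Suc m) - succ_time I ht tau Delta m = (real (?e (Suc m)) - real (?e m)) * Delta"
    by (simp add: succ_time_def algebra_simps)
  have step: "?e m < ?e (Suc m)" by (rule enumerate_step[OF infinite_successes])
  then have "1 * Delta \<le> (real (?e (Suc m)) - real (?e m)) * Delta"
    using Delta_pos by (intro mult_right_mono) auto
  then show "Delta \<le> succ_time I ht tau Delta (Suc m) - succ_time I ht tau Delta m"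
    by (simp add: diff)
  have "?e m \<in> successes" by (rule enumerate_in_set[OF infinite_successes])
  then obtain k' where k': "k' > ?e m" "k' \<in> successes" "(real k' - real (?e m)) * Delta \<le> Q + Delta"
    using next_success by blast
  have "?e (Suc m) \<le> k'"
    unfolding enumerate_Suc''[OF infinite_successes] using k' by (intro Least_le) auto
  then have "(real (?e (Suc m)) - real (?e m)) * Delta \<le> (real k' - real (?e m)) * Delta"
    using Delta_pos by (intro mult_right_mono) auto
  then show "succ_time I ht tau Delta (Suc m) - succ_time I ht tau Delta m \<le> Q + Delta"
    using k'(3) by (simp add: diff)
qed

end

section \<open>Stability of the closed loop\<close>

text \<open>\<open>C / (1 - l)\<close> is the fixed point of the worst-case recursion; any bound at
  or above it is preserved.\<close>

lemma perturbed_contraction_bounded: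
  fixes v c :: "nat \<Rightarrow> real"
  assumes "0 \<le> l" "l < 1" and step: "\<And>m. v (Suc m) \<le> l * v m + c m" and c: "\<And>m. c m \<le> C"
  shows "v m \<le> max (v 0) (C / (1 - l))"
proof (induction m)
  case (Suc m)
  let ?b = "max (v 0) (C / (1 - l))"
  have "C = (1 - l) * (C / (1 - l))" using \<open>l < 1\<close> by simp
  also have "\<dots> \<le> (1 - l) * ?b" using \<open>l < 1\<close> by (intro mult_left_mono) auto
  finally have "C \<le> (1 - l) * ?b" .
  moreover have "l * v m \<le> l * ?b" using Suc \<open>0 \<le> l\<close> by (rule mult_left_mono)
  ultimately have "v (Suc m) \<le> l * ?b + (1 - l) * ?b" using step[of m] c[of m] by linarith
  then show ?case by (simp add: algebra_simps)
qed simp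

lemma perturbed_contraction_tendsto_zero:
  fixes v c :: "nat \<Rightarrow> real"
  assumes l: "0 \<le> l" "l < 1" and nonneg: "\<And>m. 0 \<le> v m"
    and step: "\<And>m. v (Suc m) \<le> l * v m + c m" and c: "c \<longlonglongrightarrow> 0"
  shows "v \<longlonglongrightarrow> 0"
proof (rule LIMSEQ_I)
  fix e :: real assume "e > 0"
  define e' where "e' = e / 2"
  have e': "e' > 0" "(1 - l) * e' > 0" using \<open>e > 0\<close> l by (auto simp: e'_def)
  obtain N where N: "\<And>m. m \<ge> N \<Longrightarrow> c m < (1 - l) * e'"
    using LIMSEQ_D[OF c e'(2)] by (auto simp: abs_less_iff)
  have bound: "v (N + k) - e' \<le> l ^ k * (v N - e')" for k
  proof (induction k)
    case (Suc k)
    have "l * (v (N + k) - e') \<le> l * (l ^ k * (v N - e'))"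
      using Suc l(1) by (rule mult_left_mono)
    then show ?case using step[of "N + k"] N[of "N + k"] by (simp add: algebra_simps)
  qed simp
  have "(\<lambda>k. l ^ k * (v N - e')) \<longlonglongrightarrow> 0"
    using l by (intro tendsto_mult_left_zero LIMSEQ_power_zero) simp
  then obtain N' where N': "\<And>k. k \<ge> N' \<Longrightarrow> l ^ k * (v N - e') < e'"
    using LIMSEQ_D[OF _ e'(1)] by (fastforce simp: abs_less_iff)
  have "norm (v m - 0) < e" if "m \<ge> N + N'" for m
  proof -
    have "N' \<le> m - N" using that by simp
    then have "v (N + (m - N)) < e"
      using bound[of "m - N"] N'[of "m - N"] unfolding e'_def by linarith
    then show ?thesis using nonneg[of m] that by simp
  qed
  then show "\<exists>no. \<forall>m\<ge>no. norm (v m - 0) < e" by blast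
qed

lemma period_exists:
  fixes z :: "nat \<Rightarrow> real"
  assumes "0 < Lmin" "\<And>m. Lmin \<le> z (Suc m) - z m" "z 0 \<le> t"
  shows "\<exists>m. z m \<le> t \<and> t < z (Suc m)"
proof -
  have grow: "z 0 + real m * Lmin \<le> z m" for m
  proof (induction m)
    case (Suc m)
    then show ?case using assms(2)[of m] by (simp add: algebra_simps)
  qed simp
  obtain k :: nat where "(t - z 0) / Lmin < real k" using reals_Archimedean2 by blast
  then have "t - z 0 < real k * Lmin" using assms(1) by (simp only: pos_divide_less_eq)
  then have ex: "t < z k" using grow[of k] by linarith
  define j where "j = (LEAST k. t < z k)"
  have j: "t < z j" unfolding j_def using ex by (rule LeastI)
  then have "j \<noteq> 0" using assms(3) by (metis leD)
  then obtain m where "j = Suc m" by (cases j) auto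
  moreover have "\<not> t < z m"
    using not_less_Least[of m "\<lambda>k. t < z k"] \<open>j = Suc m\<close> by (simp add: j_def)
  ultimately show ?thesis using j by (auto simp: not_less)
qed

lemma periodwise_tendsto_zero:
  fixes f :: "real \<Rightarrow> 'a::real_normed_vector" and z :: "nat \<Rightarrow> real"
  assumes "0 < Lmin" and gap: "\<And>m. Lmin \<le> z (Suc m) - z m"
    and bound: "\<And>m t. z m \<le> t \<Longrightarrow> t < z (Suc m) \<Longrightarrow> norm (f t) \<le> r m" and r: "r \<longlonglongrightarrow> 0"
  shows "(f \<longlongrightarrow> 0) at_top"
proof (rule tendstoI)
  fix e :: real assume "e > 0"
  obtain N where N: "\<And>m. m \<ge> N \<Longrightarrow> r m < e"
    using LIMSEQ_D[OF r \<open>e > 0\<close>] by (auto simp: abs_less_iff)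
  have mono: "z m \<le> z m'" if "m \<le> m'" for m m'
  proof (rule lift_Suc_mono_le[OF _ that])
    show "z n \<le> z (Suc n)" for n using gap[of n] \<open>0 < Lmin\<close> by linarith
  qed
  have "dist (f t) 0 < e" if "t \<ge> z N" for t
  proof -
    have "z 0 \<le> t" using mono[of 0 N] that by simp
    then obtain m where m: "z m \<le> t" "t < z (Suc m)"
      using period_exists[of Lmin z t] \<open>0 < Lmin\<close> gap by blast
    have "N \<le> m"
    proof (rule ccontr)
      assume "\<not> N \<le> m"
      then have "z (Suc m) \<le> z N" by (intro mono) simp
      then show False using m that by linarith
    qed
    then show ?thesis using bound[OF m] N[of m] by simp
  qed
  then show "\<forall>\<^sub>F t in at_top. dist (f t) 0 < e"
    unfolding eventually_at_top_linorder by blast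
qed

lemma ctrl_input_period:
  assumes mono: "\<And>m. z m \<le> z (Suc m)" and t: "z m \<le> t" "t < z (Suc m)"
  shows "ctrl_input A B K delta h z y t
    = K *v pred_state A B K delta (y (z m)) (packet_index delta h (t - z m))"
proof -
  have "(LEAST m. t < z (Suc m)) = m"
  proof (rule Least_equality)
    show "t < z (Suc m)" by (rule t)
    fix m' assume m': "t < z (Suc m')"
    show "m \<le> m'"
    proof (rule ccontr)
      assume "\<not> m \<le> m'"
      then have "z (Suc m') \<le> z m" by (intro lift_Suc_mono_le[of z, OF mono]) simp
      then show False using m' t by linarith
    qed
  qed
  moreover have "z 0 \<le> z m" by (intro lift_Suc_mono_le[of z, OF mono]) simp
  ultimately show ?thesis using t by (simp add: ctrl_input_def packet_index_def Let_def)
qed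

text \<open>Denial of service enters only through the two-sided bound on the gaps of
  \<open>z\<close>: \<open>Lmin\<close> makes the periods exhaust the time axis, \<open>Lmax\<close>
  limits the time without fresh data.\<close>

lemma (in predictive_loop) closed_loop_stable:
  fixes x d nse :: "real \<Rightarrow> real^'n" and u :: "real \<Rightarrow> real^'m" and z :: "nat \<Rightarrow> real"
  assumes z0: "0 \<le> z 0" and Lmin: "0 < Lmin" "\<And>m. Lmin \<le> z (Suc m) - z m"
    and Lmax: "\<And>m. z (Suc m) - z m \<le> Lmax"
    and horizon: "real h * delta > omega2 / (omega1 + omega2) * Lmax"
    and dbdd: "bounded (d ` {0..})" and nbdd: "bounded (nse ` {0..})"
    and u: "u = ctrl_input A B K delta h z (\<lambda>s. x s + nse s)"
    and sol: "\<And>t. 0 \<le> t \<Longrightarrow> ((\<lambda>s. A *v x s + B *v u s + d s) has_integral (x t - x 0)) {0..t}"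
  shows "bounded (x ` {0..})" "bounded (u ` {0..})"
    "(d \<longlongrightarrow> 0) at_top \<Longrightarrow> (nse \<longlongrightarrow> 0) at_top \<Longrightarrow> (x \<longlongrightarrow> 0) at_top"
    "(d \<longlongrightarrow> 0) at_top \<Longrightarrow> (nse \<longlongrightarrow> 0) at_top \<Longrightarrow> (u \<longlongrightarrow> 0) at_top"
proof -
  let ?f = "\<lambda>s. A *v x s + B *v u s + d s"
  have z_step: "z m \<le> z (Suc m)" for m using Lmin(1) Lmin(2)[of m] by linarith
  have z_nonneg: "0 \<le> z m" for m
    using z0 lift_Suc_mono_le[of z, OF z_step, of 0 m] by simp
  have sol': "(?f has_integral x t - x a) {a..t}" if "0 \<le> a" "a \<le> t" for a t
  proof -
    have int: "?f integrable_on {0..t}" using sol[of t] that by auto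
    have "integral {0..a} ?f + integral {a..t} ?f = integral {0..t} ?f"
      using that by (intro Henstock_Kurzweil_Integration.integral_combine[OF _ _ int])
    moreover have "integral {0..a} ?f = x a - x 0" "integral {0..t} ?f = x t - x 0"
      using sol[of a] sol[of t] that by (auto intro: integral_unique)
    ultimately have "(x a - x 0) + integral {a..t} ?f = x t - x 0" by (simp only:)
    then have "integral {a..t} ?f = (x t - x 0) - (x a - x 0)"
      by (rule add_implies_diff[OF trans[OF add.commute]])
    moreover have "?f integrable_on {a..t}"
      using that by (intro integrable_subinterval_real[OF int]) auto
    from integrable_integral[OF this]
    have "(?f has_integral integral {a..t} ?f) {a..t}" .
    ultimately show ?thesis by (simp only: diff_diff_eq2 diff_add_cancel)
  qed
  obtain Nd where Nd: "\<And>t. 0 \<le> t \<Longrightarrow> norm (d t) \<le> Nd" using dbdd by (auto simp: bounded_iff)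
  obtain Nn where Nn: "\<And>t. 0 \<le> t \<Longrightarrow> norm (nse t) \<le> Nn" using nbdd by (auto simp: bounded_iff)
  \<comment> \<open>The supremum runs over the whole future of \<open>z m\<close>, not just one
    period. It stays bounded with \<open>d\<close> and \<open>nse\<close>, and tends to zero as soon
    as they do.\<close>
  define w where "w m = (SUP t\<in>{z m..}. norm (d t) + norm (nse t))" for m
  have bdd: "bdd_above ((\<lambda>t. norm (d t) + norm (nse t)) ` {z m..})" for m
  proof (rule bdd_aboveI2)
    show "norm (d t) + norm (nse t) \<le> Nd + Nn" if "t \<in> {z m..}" for t
      using that z_nonneg[of m] by (intro add_mono Nd Nn) auto
  qed
  have w_upper: "norm (d t) + norm (nse t) \<le> w m" if "z m \<le> t" for t m
    unfolding w_def using that by (intro cSUP_upper[OF _ bdd]) simp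
  have w_d: "norm (d t) \<le> w m" and w_n: "norm (nse t) \<le> w m" if "z m \<le> t" for t m
    using w_upper[OF that] norm_ge_zero[of "d t"] norm_ge_zero[of "nse t"] by linarith+
  have w_nonneg: "0 \<le> w m" for m using w_d[of m "z m"] norm_ge_zero order_trans by blast
  have w_least: "w m \<le> e" if "\<And>t. z m \<le> t \<Longrightarrow> norm (d t) + norm (nse t) \<le> e" for m e
    unfolding w_def using that by (intro cSUP_least) auto
  have w_bdd: "w m \<le> Nd + Nn" for m
    using z_nonneg[of m] by (intro w_least add_mono Nd Nn) auto
  have w_lim: "w \<longlonglongrightarrow> 0" if lim: "(d \<longlongrightarrow> 0) at_top" "(nse \<longlongrightarrow> 0) at_top"
  proof (rule LIMSEQ_I)
    fix e :: real assume "e > 0"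
    have "((\<lambda>t. norm (d t) + norm (nse t)) \<longlongrightarrow> 0) at_top"
      using tendsto_add[OF tendsto_norm_zero[OF lim(1)] tendsto_norm_zero[OF lim(2)]] by simp
    from tendstoD[OF this, of "e / 2"] \<open>e > 0\<close>
    obtain t0 where t0: "\<And>t. t \<ge> t0 \<Longrightarrow> norm (d t) + norm (nse t) < e / 2"
      by (auto simp: eventually_at_top_linorder)
    obtain N where N: "t0 \<le> z N"
    proof (cases "t0 \<le> z 0")
      case False
      then have "z 0 \<le> t0" by simp
      then obtain m where "t0 < z (Suc m)" using period_exists[of Lmin z t0] Lmin by blast
      then show ?thesis using that[of "Suc m"] by simp
    qed (use that in blast)
    have "norm (w m - 0) < e" if "m \<ge> N" for m
    proof -
      have "t0 \<le> z m" using N lift_Suc_mono_le[of z, OF z_step that] by simp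
      then have "w m \<le> e / 2" using t0 by (intro w_least) (auto intro: less_imp_le)
      then show ?thesis using w_nonneg[of m] \<open>e > 0\<close> by simp
    qed
    then show "\<exists>no. \<forall>m\<ge>no. norm (w m - 0) < e" by blast
  qed
  have u_eq: "u t = K *v pred_state A B K delta (x (z m) + nse (z m)) (packet_index delta h (t - z m))"
    if "z m \<le> t" "t < z (Suc m)" for m t
    unfolding u by (rule ctrl_input_period[OF z_step that])
  have err: "\<exists>C\<ge>0. \<forall>m t. 0 \<le> t \<longrightarrow> t \<le> z (Suc m) - z m \<longrightarrow>
      norm (x (z m + t) - nominal A B K delta h (x (z m)) t) \<le> C * w m"
  proof -
    obtain C where C: "C \<ge> 0" and Cerr: "\<And>X U D n w L t. L \<le> Lmax \<Longrightarrow>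
        perturbed_period A B K delta h X U D n w L \<Longrightarrow> 0 \<le> t \<Longrightarrow> t \<le> L \<Longrightarrow>
        norm (X t - nominal A B K delta h (X 0) t) \<le> C * w"
      using perturbed_period_error[OF pos(5,6), of Lmax A B K] by auto
    have "norm (x (z m + t) - nominal A B K delta h (x (z m)) t) \<le> C * w m"
      if t: "0 \<le> t" "t \<le> z (Suc m) - z m" for m t
    proof -
      have "perturbed_period A B K delta h (\<lambda>s. x (z m + s)) (\<lambda>s. u (z m + s)) (\<lambda>s. d (z m + s))
          (nse (z m)) (w m) (z (Suc m) - z m)"
        unfolding perturbed_period_def
      proof (intro conjI allI impI)
        fix a t :: real assume at: "0 \<le> a" "a \<le> t"
        have "(?f has_integral x (z m + t) - x (z m + a)) {a + z m..t + z m}"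
          using sol'[of "a + z m" "t + z m"] at z_nonneg[of m] by (simp add: add.commute)
        then show "((\<lambda>s. A *v x (z m + s) + B *v u (z m + s) + d (z m + s)) has_integral
            x (z m + t) - x (z m + a)) {a..t}"
          unfolding has_integral_shift_Icc_real[symmetric] by (simp add: o_def)
      next
        fix t :: real assume "0 \<le> t" "t < z (Suc m) - z m"
        then show "u (z m + t) =
            K *v pred_state A B K delta (x (z m + 0) + nse (z m)) (packet_index delta h t)"
          using u_eq[of m "z m + t"] by simp
      qed (auto intro: w_d w_n)
      from Cerr[OF Lmax this t] show ?thesis by simp
    qed
    then show ?thesis using C by blast
  qed
  then obtain C where C: "C \<ge> 0" "\<And>m t. 0 \<le> t \<Longrightarrow> t \<le> z (Suc m) - z m \<Longrightarrow>
      norm (x (z m + t) - nominal A B K delta h (x (z m)) t) \<le> C * w m" by blast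
  obtain l where l: "0 < l" "l < 1" "\<And>s v. Lmin \<le> s \<Longrightarrow> s \<le> Lmax \<Longrightarrow> V (nominal A B K delta h v s) \<le> l * V v"
    using V_nominal_contraction[OF Lmin(1) horizon] by blast
  \<comment> \<open>Chosen so that \<open>(1 + c) * l\<close> is the midpoint of \<open>l\<close>
    and one, which keeps the perturbed recursion contractive.\<close>
  define c where "c = (1 - l) / (2 * l)"
  have c: "c > 0" "(1 + c) * l = (1 + l) / 2" using l by (auto simp: c_def field_simps)
  define v where "v m = V (x (z m))" for m
  have v_nonneg: "0 \<le> v m" for m by (simp add: v_def V_nonneg)
  define k where "k = (1 + 1 / c) * alpha2 * C\<^sup>2"
  have k: "k \<ge> 0" using c pos by (simp add: k_def)
  have step: "v (Suc m) \<le> (1 + l) / 2 * v m + k * (w m)\<^sup>2" for m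
  proof -
    let ?L = "z (Suc m) - z m"
    let ?n = "nominal A B K delta h (x (z m)) ?L"
    let ?e = "x (z (Suc m)) - ?n"
    have e: "norm ?e \<le> C * w m" using C(2)[of ?L m] z_step[of m] by simp
    have "v (Suc m) = V (?n + ?e)" by (simp add: v_def)
    also have "\<dots> \<le> (1 + c) * V ?n + (1 + 1 / c) * V ?e" by (rule V_add_le[OF c(1)])
    also have "(1 + c) * V ?n \<le> (1 + c) * (l * v m)"
      unfolding v_def using c Lmin(2) Lmax by (intro mult_left_mono l(3)) auto
    also have "(1 + c) * (l * v m) = (1 + l) / 2 * v m" using c(2) by (simp only: mult.assoc[symmetric])
    also have "(1 + 1 / c) * V ?e \<le> (1 + 1 / c) * (alpha2 * (C * w m)\<^sup>2)"
      using c pos e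
      by (intro mult_left_mono order_trans[OF P_upper] power_mono) auto
    also have "\<dots> = k * (w m)\<^sup>2" by (simp add: k_def power_mult_distrib)
    finally show ?thesis by simp
  qed
  have l': "0 \<le> (1 + l) / 2" "(1 + l) / 2 < 1" using l by auto
  have norm_le: "norm y \<le> sqrt (V y / alpha1)" for y
  proof (rule real_le_rsqrt)
    show "(norm y)\<^sup>2 \<le> V y / alpha1" using P_lower[of y] pos by (simp add: pos_le_divide_eq mult.commute)
  qed
  \<comment> \<open>The worst nominal amplification inside a period, converted from \<open>V\<close>
    to norms.\<close>
  define q where "q = sqrt (exp (omega2 * Lmax) / alpha1)"
  have x_bound: "norm (x t) \<le> q * sqrt (v m) + C * w m" if t: "z m \<le> t" "t < z (Suc m)" for m t
  proof -
    let ?n = "nominal A B K delta h (x (z m)) (t - z m)"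
    have "norm (x t - ?n) \<le> C * w m" using C(2)[of "t - z m" m] t by simp
    moreover have "norm ?n \<le> q * sqrt (v m)"
    proof -
      have "V ?n \<le> exp (omega2 * Lmax) * v m"
        unfolding v_def using t Lmax[of m] by (intro V_nominal_bounded) auto
      then have "V ?n / alpha1 \<le> exp (omega2 * Lmax) / alpha1 * v m"
        using pos by (simp add: divide_right_mono)
      then have "sqrt (V ?n / alpha1) \<le> sqrt (exp (omega2 * Lmax) / alpha1 * v m)"
        by (rule real_sqrt_le_mono)
      then show ?thesis using norm_le[of ?n] by (simp only: q_def real_sqrt_mult)
    qed
    ultimately show ?thesis using norm_triangle_sub[of "x t" ?n] by linarith
  qed
  obtain cp where cp: "cp \<ge> 1" "\<And>p y. p < h \<Longrightarrow> norm (pred_state A B K delta y p) \<le> cp * norm y"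
    using pred_state_bound[of h A B K delta] by auto
  have u_bound: "norm (u t) \<le> opnorm K * (cp * (sqrt (v m / alpha1) + w m))"
    if t: "z m \<le> t" "t < z (Suc m)" for m t
  proof -
    have "packet_index delta h (t - z m) < h" using pos by (auto simp: packet_index_def)
    moreover have "norm (x (z m) + nse (z m)) \<le> sqrt (v m / alpha1) + w m"
      unfolding v_def by (intro norm_triangle_mono norm_le w_n) simp
    ultimately have "norm (pred_state A B K delta (x (z m) + nse (z m)) (packet_index delta h (t - z m)))
        \<le> cp * (sqrt (v m / alpha1) + w m)"
      using cp(1) by (intro order_trans[OF cp(2) mult_left_mono]) auto
    then show ?thesis
      unfolding u_eq[OF t] by (intro order_trans[OF opnorm_bound mult_left_mono] opnorm_nonneg)
  qed
  define R where "R = max (v 0) (k * (Nd + Nn)\<^sup>2 / (1 - (1 + l) / 2))"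
  have v_bdd: "v m \<le> R" for m
    unfolding R_def
    by (rule perturbed_contraction_bounded[where v = v and c = "\<lambda>m. k * (w m)\<^sup>2", OF l' step])
      (intro mult_left_mono power_mono w_bdd w_nonneg k)
  have q: "q \<ge> 0" using pos by (simp add: q_def)
  have bounded_after: "\<exists>b. \<forall>t\<ge>z 0. norm (g t) \<le> b"
    if "\<And>m t. z m \<le> t \<Longrightarrow> t < z (Suc m) \<Longrightarrow> norm (g t) \<le> b" for g :: "real \<Rightarrow> 'c::real_normed_vector" and b
    using that period_exists[of Lmin z] Lmin by meson
  have "norm (x t) \<le> q * sqrt R + C * (Nd + Nn)" if "z m \<le> t" "t < z (Suc m)" for m t
    by (rule order_trans[OF x_bound[OF that]])
      (intro add_mono mult_left_mono real_sqrt_le_mono v_bdd w_bdd q C(1))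
  then obtain bx where bx: "\<And>t. z 0 \<le> t \<Longrightarrow> norm (x t) \<le> bx" using bounded_after by blast
  \<comment> \<open>The time before the first success belongs to no period; there the state is
    bounded by continuity on a compact interval.\<close>
  have "continuous_on {0..z 0} (\<lambda>t. x 0 + integral {0..t} ?f)"
    using sol[OF z0] by (intro continuous_intros indefinite_integral_continuous_1) auto
  then have "continuous_on {0..z 0} x"
    by (rule continuous_on_eq) (simp add: integral_unique[OF sol])
  then have "bounded (x ` {0..z 0})" by (intro compact_imp_bounded compact_continuous_image) auto
  moreover have "bounded (x ` {z 0..})" unfolding bounded_iff using bx by auto
  ultimately have "bounded (x ` ({0..z 0} \<union> {z 0..}))" by (simp add: image_Un)
  then show "bounded (x ` {0..})" by (rule bounded_subset) (intro image_mono, auto)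
  have "norm (u t) \<le> opnorm K * (cp * (sqrt (R / alpha1) + (Nd + Nn)))"
    if "z m \<le> t" "t < z (Suc m)" for m t
    using cp(1) pos
    by (intro order_trans[OF u_bound[OF that]] mult_left_mono add_mono real_sqrt_le_mono
        divide_right_mono v_bdd w_bdd opnorm_nonneg) auto
  then obtain bu where bu: "\<And>t. z 0 \<le> t \<Longrightarrow> norm (u t) \<le> bu" using bounded_after by blast
  \<comment> \<open>The zero accounts for the default input applied before the first
    success.\<close>
  have "norm (u t) \<le> max bu 0" for t
    using bu[of t] by (cases "t < z 0") (auto simp: u ctrl_input_def le_max_iff_disj)
  then show "bounded (u ` {0..})" by (auto simp: bounded_iff)
  assume lim: "(d \<longlongrightarrow> 0) at_top" "(nse \<longlongrightarrow> 0) at_top"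
  have w0: "w \<longlonglongrightarrow> 0" by (rule w_lim[OF lim])
  have "(\<lambda>m. k * (w m)\<^sup>2) \<longlonglongrightarrow> k * 0\<^sup>2" by (intro tendsto_intros w0)
  then have "v \<longlonglongrightarrow> 0"
    by (intro perturbed_contraction_tendsto_zero[where v = v and c = "\<lambda>m. k * (w m)\<^sup>2",
          OF l' v_nonneg step]) simp
  have "(\<lambda>m. q * sqrt (v m) + C * w m) \<longlonglongrightarrow> q * sqrt 0 + C * 0"
    by (intro tendsto_intros w0 \<open>v \<longlonglongrightarrow> 0\<close>)
  then show "(x \<longlongrightarrow> 0) at_top"
    using Lmin x_bound
    by (intro periodwise_tendsto_zero[of Lmin z x "\<lambda>m. q * sqrt (v m) + C * w m"]) simp_all
  have "(\<lambda>m. opnorm K * (cp * (sqrt (v m / alpha1) + w m))) \<longlonglongrightarrow> opnorm K * (cp * (sqrt (0 / alpha1) + 0))"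
    using pos by (intro tendsto_intros w0 \<open>v \<longlonglongrightarrow> 0\<close>) auto
  then show "(u \<longlongrightarrow> 0) at_top"
    using Lmin u_bound
    by (intro periodwise_tendsto_zero[of Lmin z u "\<lambda>m. opnorm K * (cp * (sqrt (v m / alpha1) + w m))"]) simp_all
qed

theorem theorem2:
  fixes A :: "real^'n^'n" and B :: "real^'m^'n" and K :: "real^'n^'m"
    and M P :: "real^'n^'n"
    and x0 :: "real^'n" and d nse x :: "real \<Rightarrow> real^'n"
    and Delta delta sigma eta tauD kappa T :: real and b h :: nat
    and I :: "nat set" and ht tau :: "nat \<Rightarrow> real"
    and alpha1 alpha2 gamma1 gamma2 muA omega1 omega2 Q :: real
    and z :: "nat \<Rightarrow> real" and u :: "real \<Rightarrow> real^'m"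
  assumes Phi: "hurwitz (A + B ** K)"
    and Msp: "sym_posdef M"
    and Lyap: "transpose (A + B ** K) ** P + P ** (A + B ** K) + M = 0"
    and a1: "alpha1 = Min (real_eigenvalues P)"
    and a2: "alpha2 = Max (real_eigenvalues P)"
    and g1: "gamma1 = Min (real_eigenvalues M)"
    and g2: "gamma2 = opnorm (2 *\<^sub>R (P ** B ** K))"
    and mu: "muA = Max (real_eigenvalues ((1/2) *\<^sub>R (A + transpose A)))"
    and sig: "sigma > 0" "gamma1 - sigma * gamma2 > 0"
    and Delta_pos: "Delta > 0"
    and b: "b \<ge> 1" and delta_def: "delta = Delta / real b"
    and samp: "(muA > 0 \<longrightarrow> delta \<le> (1 / muA) *
                   ln ((sigma / (1 + sigma)) * (muA / max (opnorm (A + B ** K)) 1) + 1))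
             \<and> (muA \<le> 0 \<longrightarrow> delta \<le> (sigma / (1 + sigma)) * (1 / max (opnorm (A + B ** K)) 1))"
    and hpos: "h \<ge> 1"
    and dos: "dos_signal I ht tau"
    and A1: "eta \<ge> 0" "tauD > 0" "dos_frequency I ht eta tauD"
    and A2: "kappa \<ge> 0" "T > 1" "dos_duration I ht tau kappa T"
    and rate: "1 / T + Delta / tauD < 1"
    and om1: "omega1 = (gamma1 - sigma * gamma2) / (2 * alpha2)"
    and om2: "omega2 = gamma2 * (2 + sigma) / alpha1"
    and Qdef: "Q = (kappa + eta * Delta) / (1 - 1 / T - Delta / tauD)"
    and horizon: "real h * delta > omega2 / (omega1 + omega2) * (Q + Delta)"
    and dmeas: "(\<lambda>t. indicator {0..} t *\<^sub>R d t) \<in> borel_measurable lebesgue" and dbdd: "bounded (d ` {0..})"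
    and nmeas: "(\<lambda>t. indicator {0..} t *\<^sub>R nse t) \<in> borel_measurable lebesgue" and nbdd: "bounded (nse ` {0..})"
    and zdef: "z = succ_time I ht tau Delta"
    and udef: "u = ctrl_input A B K delta h z (\<lambda>s. x s + nse s)"
    and init: "x 0 = x0"
    and sol: "\<forall>t\<ge>0. ((\<lambda>s. A *v x s + B *v u s + d s) has_integral (x t - x0)) {0..t}"
  shows "bounded (x ` {0..}) \<and> bounded (u ` {0..}) \<and>
         ((d \<longlongrightarrow> 0) at_top \<and> (nse \<longlongrightarrow> 0) at_top \<longrightarrow>
            (x \<longlongrightarrow> 0) at_top \<and> (u \<longlongrightarrow> 0) at_top)"
proof -
  have P_posdef: "sym_posdef P" by (rule lyapunov_solution_posdef[OF Phi Msp Lyap])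
  have P_sym: "transpose P = P" using P_posdef by (simp add: sym_posdef_def)
  have M_sym: "transpose M = M" using Msp by (simp add: sym_posdef_def)
  \<comment> \<open>The quadratic forms of \<open>A\<close> and of its symmetric part coincide, so
    the Rayleigh bound carries over to \<open>A\<close>.\<close>
  have mu_bound: "y \<bullet> (A *v y) \<le> muA * (norm y)\<^sup>2" for y
  proof -
    let ?S = "(1/2) *\<^sub>R (A + transpose A)"
    have "transpose ?S = ?S" by (simp add: transpose_def vec_eq_iff add.commute)
    then have "y \<bullet> (?S *v y) \<le> muA * (norm y)\<^sup>2" unfolding mu by (rule rayleigh_le_Max)
    moreover have "y \<bullet> (transpose A *v y) = y \<bullet> (A *v y)"
      by (metis inner_commute inner_matrix_transpose)
    then have "y \<bullet> (?S *v y) = y \<bullet> (A *v y)"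
      by (simp add: matrix_vector_mult_add_rdistrib inner_add_right del: transpose_matrix_vector
          flip: scaleR_matrix_vector_assoc)
    ultimately show ?thesis by simp
  qed
  have delta_pos: "0 < delta" using Delta_pos b delta_def by simp
  interpret predictive_loop A B K M P delta sigma alpha1 alpha2 gamma1 gamma2 omega1 omega2 h
  proof
    show "norm (v - flow A B K r v) \<le> sigma / (1 + sigma) * norm v"
      if "0 \<le> r" "r \<le> delta" for r v
      using samp sig(1) that by (intro flow_deviation[OF mu_bound, where delta = delta]) auto
    show "0 < alpha1" unfolding a1 by (rule posdef_Min_eigenvalue_pos[OF P_posdef])
    show "0 < alpha2" unfolding a2 by (rule posdef_Max_eigenvalue_pos[OF P_posdef])
    show "alpha1 * (norm y)\<^sup>2 \<le> y \<bullet> (P *v y)" for y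
      unfolding a1 by (rule Min_le_rayleigh[OF P_sym])
    show "y \<bullet> (P *v y) \<le> alpha2 * (norm y)\<^sup>2" for y
      unfolding a2 by (rule rayleigh_le_Max[OF P_sym])
    show "gamma1 * (norm y)\<^sup>2 \<le> y \<bullet> (M *v y)" for y
      unfolding g1 by (rule Min_le_rayleigh[OF M_sym])
  qed fact+
  interpret dos_attack I ht tau Delta eta tauD kappa T Q
    by unfold_locales fact+
  have sol': "((\<lambda>s. A *v x s + B *v u s + d s) has_integral (x t - x 0)) {0..t}" if "0 \<le> t" for t
    using sol that by (simp add: init)
  note stable = closed_loop_stable[of z Delta "Q + Delta" d nse u x,
      OF _ Delta_pos _ _ horizon dbdd nbdd udef sol']
  \<comment> \<open>Consecutive successes are at least one attempt interval and at most
    \<open>Q + Delta\<close> apart, the length for which the horizon condition is stated.\<close>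
  have "0 \<le> z 0" "\<And>m. Delta \<le> z (Suc m) - z m" "\<And>m. z (Suc m) - z m \<le> Q + Delta"
    unfolding zdef by (rule succ_time_nonneg succ_time_gap)+
  then show ?thesis using stable by blast
qed

end
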